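(* Let $\mathbb G$ be an ideal Carnot group with CC distance $d$ and $d_0=d(\cdot,0)$. Then $d_0^2$ is h-semiconcave in $\mathbb G$.
   Context: A Carnot group is ideal if (equivalently) it is fat: it has step 2 (see below) and for every $X\in\mathfrak g_1\setminus\{0\}$, $\mathfrak g_1+[\mathfrak g_1,X]=\mathfrak g$; equivalently, its canonical sub-Riemannian structure is complete and admits no non-constant abnormal length-minimizing geodesics. A step 2 Carnot group $\mathbb G$ is a connected, simply connected Lie group whose Lie algebra splits as $\mathfrak g=\mathfrak g_1\oplus\mathfrak g_2$ with $[\mathfrak g_1,\mathfrak g_1]=\mathfrak g_2\neq\{0\}$, $[\mathfrak g_1,\mathfrak g_2]=\{0\}$; it is identified with $\mathbb R^n=\mathbb R^m\times\mathbb R^{n_2}$, $p=(p^{(1)},p^{(2)})$, with law $p\cdot q=(p^{(1)}+q^{(1)},p^{(2)}+q^{(2)}+\mathcal B(p^{(1)},q^{(1)}))$, $\mathcal B$ skew-symmetric bilinear; identity $0$, $p^{-1}=-p$. $X_1,\dots,X_m$ are the left-invariant vector fields equal to $\partial/\partial p_i$ at $0$. The CC distance $d(p,q)$ is the infimum of $\int_0^1|u|$ over absolutely continuous $\gamma:[0,1]\to\mathbb G$ from $p$ to $q$ with $\dot\gamma=\sum u_iX_i(\gamma)$ a.e. $\mathcal H_0=\mathbb R^m\times\{0\}$; $|\cdot|$ is the Euclidean norm. A lower semicontinuous $u$ on open $\Omega$ is h-semiconcave if there is $C\ge0$ with $u(p\cdot h)+u(p\cdot h^{-1})-2u(p)\le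 C|h|^2$ for all $p\in\Omega$, $h\in\mathcal H_0$ with $\{p\cdot\tau h:\tau\in[-1,1]\}\subset\Omega$. *)

theory Defs
  imports "HOL-Analysis.Analysis"
begin

text \<open>Step 2 Carnot group modelled on R^m x R^k (types 'm, 'k) with law
  p \<cdot> q = (p1 + q1, p2 + q2 + B p1 q1), B skew-symmetric bilinear.\<close>

type_synonym ('m, 'k) pt = "(real ^ 'm) \<times> (real ^ 'k)"

definition gmul :: "(real ^ ('m::finite) \<Rightarrow> real ^ 'm \<Rightarrow> real ^ ('k::finite)) \<Rightarrow> ('m, 'k) pt \<Rightarrow> ('m, 'k) pt \<Rightarrow> ('m, 'k) pt" where
  "gmul B p q = (fst p + fst q, snd p + snd q + B (fst p) (fst q))"

definition ginv :: "('m::finite, 'k::finite) pt \<Rightarrow> ('m, 'k) pt" where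
  "ginv p = - p"

text \<open>Structure conditions: B skew-symmetric bilinear, [g1,g1] = g2 (the bracket of
  horizontal left-invariant fields X, Y is 2 B X Y in these coordinates).\<close>
definition step2_carnot :: "(real ^ ('m::finite) \<Rightarrow> real ^ 'm \<Rightarrow> real ^ ('k::finite)) \<Rightarrow> bool" where
  "step2_carnot B \<longleftrightarrow> bilinear B \<and> (\<forall>x y. B x y = - B y x)
     \<and> span {2 *\<^sub>R B x y | x y. True} = UNIV"

text \<open>Ideal (= fat): for every nonzero horizontal X, g1 + [g1, X] = g, i.e. the
  second-layer part {[Y,X] | Y in g1} is all of g2.\<close>
definition ideal_carnot :: "(real ^ ('m::finite) \<Rightarrow> real ^ 'm \<Rightarrow> real ^ ('k::finite)) \<Rightarrow> bool" where
  "ideal_carnot B \<longleftrightarrow> step2_carnot B \<and>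
     (\<forall>x. x \<noteq> 0 \<longrightarrow>
        {(y, 0) + (0, 2 *\<^sub>R B w x) | y w. True} = (UNIV :: ('m,'k) pt set))"

definition abs_cont_on :: "(real \<Rightarrow> 'a::metric_space) \<Rightarrow> real \<Rightarrow> real \<Rightarrow> bool" where
  "abs_cont_on g a b \<longleftrightarrow> (\<forall>\<epsilon>>0. \<exists>\<delta>>0. \<forall>(n::nat) (s::nat\<Rightarrow>real) t.
      (\<forall>i<n. a \<le> s i \<and> s i \<le> t i \<and> t i \<le> b)
      \<and> (\<forall>i<n. \<forall>j<n. i \<noteq> j \<longrightarrow> t i \<le> s j \<or> t j \<le> s i)
      \<and> (\<Sum>i<n. t i - s i) < \<delta>
      \<longrightarrow> (\<Sum>i<n. dist (g (t i)) (g (s i))) < \<epsilon>)"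

definition horiz_curve :: "(real ^ ('m::finite) \<Rightarrow> real ^ 'm \<Rightarrow> real ^ ('k::finite)) \<Rightarrow> (real \<Rightarrow> ('m,'k) pt)
    \<Rightarrow> (real \<Rightarrow> real ^ 'm) \<Rightarrow> ('m,'k) pt \<Rightarrow> ('m,'k) pt \<Rightarrow> bool" where
  "horiz_curve B \<gamma> u p q \<longleftrightarrow> abs_cont_on \<gamma> 0 1 \<and> \<gamma> 0 = p \<and> \<gamma> 1 = q
     \<and> (\<lambda>t. norm (u t)) integrable_on {0..1}
     \<and> (AE t in lebesgue. t \<in> {0..1} \<longrightarrow>
          (\<gamma> has_vector_derivative
             (\<Sum>i\<in>UNIV. u t $ i *\<^sub>R (axis i 1, B (fst (\<gamma> t)) (axis i 1)))) (at t))"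

definition cc_dist :: "(real ^ ('m::finite) \<Rightarrow> real ^ 'm \<Rightarrow> real ^ ('k::finite)) \<Rightarrow> ('m,'k) pt \<Rightarrow> ('m,'k) pt \<Rightarrow> real" where
  "cc_dist B p q = Inf {integral {0..1} (\<lambda>t. norm (u t)) | \<gamma> u. horiz_curve B \<gamma> u p q}"

definition lsc_on :: "'a::topological_space set \<Rightarrow> ('a \<Rightarrow> real) \<Rightarrow> bool" where
  "lsc_on \<Omega> f \<longleftrightarrow> (\<forall>p\<in>\<Omega>. \<forall>c. c < f p \<longrightarrow> (\<forall>\<^sub>F q in at p. c < f q))"

definition h_semiconcave :: "(real ^ ('m::finite) \<Rightarrow> real ^ 'm \<Rightarrow> real ^ ('k::finite)) \<Rightarrow> ('m,'k) pt set
    \<Rightarrow> (('m,'k) pt \<Rightarrow> real) \<Rightarrow> bool" where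
  "h_semiconcave B \<Omega> f \<longleftrightarrow> lsc_on \<Omega> f \<and> (\<exists>C\<ge>0. \<forall>p\<in>\<Omega>. \<forall>h. snd h = 0 \<longrightarrow>
      (\<forall>\<tau>\<in>{-1..1}. gmul B p (\<tau> *\<^sub>R h) \<in> \<Omega>) \<longrightarrow>
      f (gmul B p h) + f (gmul B p (ginv h)) - 2 * f p \<le> C * (norm h)\<^sup>2)"

end

theory Submission
  imports Defs
begin

text \<open>
  Write \<open>d\<close> for the CC distance to the origin. Polygonal paths suffice to compute \<open>d\<close>: a horizontal
  curve is approximated by a polygon, and the small vertical error is removed by a commutator, since by
  fatness every vertical vector is a single bracket.

  Take a nearly shortest polygon to \<open>p\<close> with velocities \<open>g i\<close>, length \<open>L\<close> and relative segment lengths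
  \<open>\<tau> i\<close>, and replace \<open>g i\<close> by \<open>g i + h + adj \<mu> (dev i)\<close>. Here \<open>dev i\<close> is the deviation of the \<open>i\<close>-th
  segment midpoint from the mean, and \<open>adj \<mu> x\<close> represents the functional \<open>y \<mapsto> \<mu> \<bullet> B x y\<close>. For any
  multiplier \<open>\<mu>\<close> the new path has the correct horizontal endpoint; reaching \<open>p \<cdot> h\<close> exactly is a quadratic
  equation for \<open>\<mu>\<close>. Its linear part is coercive with constant of order \<open>L\<^sup>2\<close>: fatness bounds \<open>adj\<close> from
  below, and a nearly shortest path cannot have all its midpoints close together, by the ball-box
  estimate. Brouwer's theorem gives a solution, equal to a linear function of \<open>h\<close> up to
  \<open>O((norm h)\<^sup>2 / L\<^sup>2)\<close>. The squared length therefore exceeds \<open>L\<^sup>2\<close> by an odd function of \<open>h\<close> plus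
  \<open>O((norm h)\<^sup>2)\<close>, and the odd part cancels between \<open>h\<close> and \<open>- h\<close>. When \<open>L\<close> is at most a multiple of
  \<open>norm h\<close>, the triangle inequality suffices.
\<close>

subsection \<open>Absolutely continuous curves\<close>

lemma abs_cont_on_subinterval:
  assumes "abs_cont_on f a b" "a \<le> c" "d \<le> b"
  shows "abs_cont_on f c d"
  unfolding abs_cont_on_def
proof (intro allI impI)
  fix e :: real assume "e > 0"
  then obtain \<delta> where \<delta>: "\<delta> > 0"
    "\<And>(n::nat) (s::nat\<Rightarrow>real) t. (\<forall>i<n. a \<le> s i \<and> s i \<le> t i \<and> t i \<le> b)
      \<and> (\<forall>i<n. \<forall>j<n. i \<noteq> j \<longrightarrow> t i \<le> s j \<or> t j \<le> s i)
      \<and> (\<Sum>i<n. t i - s i) < \<delta> \<Longrightarrow> (\<Sum>i<n. dist (f (t i)) (f (s i))) < e"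
    using assms(1) unfolding abs_cont_on_def by blast
  show "\<exists>\<delta>>0. \<forall>(n::nat) (s::nat\<Rightarrow>real) t.
      (\<forall>i<n. c \<le> s i \<and> s i \<le> t i \<and> t i \<le> d)
      \<and> (\<forall>i<n. \<forall>j<n. i \<noteq> j \<longrightarrow> t i \<le> s j \<or> t j \<le> s i)
      \<and> (\<Sum>i<n. t i - s i) < \<delta>
      \<longrightarrow> (\<Sum>i<n. dist (f (t i)) (f (s i))) < e"
  proof (intro exI[of _ \<delta>] conjI allI impI \<delta>)
    fix n s t i assume "(\<forall>i<n. c \<le> s i \<and> s i \<le> t i \<and> t i \<le> d)
      \<and> (\<forall>i<n. \<forall>j<n. i \<noteq> j \<longrightarrow> t i \<le> s j \<or> t j \<le> s i)
      \<and> (\<Sum>i<n. t i - s i) < \<delta>"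
      and "i < n"
    then show "a \<le> s i" "s i \<le> t i" "t i \<le> b"
      using assms by (meson order_trans)+
  qed auto
qed

text \<open>Any finite index set can be enumerated by an initial segment of the naturals. Riemann
  sums need this form, because there the intervals are indexed by the tagged pieces
  themselves.\<close>

lemma abs_cont_on_finite_intervals:
  fixes f :: "real \<Rightarrow> 'a::real_normed_vector"
  assumes "abs_cont_on f a b" "e > 0"
  shows "\<exists>\<delta>>0. \<forall>(D::'i set) s t. finite D \<longrightarrow> (\<forall>i\<in>D. a \<le> s i \<and> s i \<le> t i \<and> t i \<le> b) \<longrightarrow>
       (\<forall>i\<in>D. \<forall>j\<in>D. i \<noteq> j \<longrightarrow> t i \<le> s j \<or> t j \<le> s i) \<longrightarrow> (\<Sum>i\<in>D. t i - s i) < \<delta> \<longrightarrow>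
       (\<Sum>i\<in>D. norm (f (t i) - f (s i))) < e"
proof -
  obtain \<delta> where \<delta>: "\<delta> > 0"
    "\<And>(n::nat) (s::nat\<Rightarrow>real) t. (\<forall>i<n. a \<le> s i \<and> s i \<le> t i \<and> t i \<le> b)
      \<and> (\<forall>i<n. \<forall>j<n. i \<noteq> j \<longrightarrow> t i \<le> s j \<or> t j \<le> s i)
      \<and> (\<Sum>i<n. t i - s i) < \<delta> \<Longrightarrow> (\<Sum>i<n. dist (f (t i)) (f (s i))) < e"
    using assms unfolding abs_cont_on_def by blast
  show ?thesis
  proof (intro exI[of _ \<delta>] conjI allI impI)
    fix D :: "'i set" and s t :: "'i \<Rightarrow> real"
    assume D: "finite D" and st: "\<forall>i\<in>D. a \<le> s i \<and> s i \<le> t i \<and> t i \<le> b"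
      and dj: "\<forall>i\<in>D. \<forall>j\<in>D. i \<noteq> j \<longrightarrow> t i \<le> s j \<or> t j \<le> s i"
      and sm: "(\<Sum>i\<in>D. t i - s i) < \<delta>"
    obtain h where h: "bij_betw h {0..<card D} D"
      using ex_bij_betw_nat_finite[OF D] by blast
    have re: "(\<Sum>i\<in>D. g i) = (\<Sum>i<card D. g (h i))" for g :: "'i \<Rightarrow> real"
      using sum.reindex_bij_betw[OF h, of g] by (simp add: atLeast0LessThan)
    have hD: "h i \<in> D" if "i < card D" for i
      using h that by (auto simp: bij_betw_def)
    have hne: "h i \<noteq> h j" if "i < card D" "j < card D" "i \<noteq> j" for i j
      using h that by (auto simp: bij_betw_def inj_on_def)
    have "(\<Sum>i<card D. dist (f (t (h i))) (f (s (h i)))) < e"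
      using \<delta>(2)[of "card D" "s \<circ> h" "t \<circ> h"] sm st dj hD hne by (simp add: re)
    then show "(\<Sum>i\<in>D. norm (f (t i) - f (s i))) < e"
      by (simp add: re dist_norm)
  qed (fact \<delta>(1))
qed

text \<open>Two distinct pieces meet in a box with empty interior, hence in a null set. So the
  contents add up to the measure of a union that lies inside \<open>U\<close>.\<close>

lemma sum_content_le_measure:
  fixes D :: "(real \<times> real set) set"
  assumes p: "p tagged_division_of {a..b}" and D: "D \<subseteq> p"
    and DU: "\<And>x K. (x, K) \<in> D \<Longrightarrow> K \<subseteq> U" and U: "U \<in> lmeasurable"
  shows "(\<Sum>(x,K)\<in>D. measure lborel K) \<le> measure lebesgue U"
proof -
  have tp: "D tagged_partial_division_of {a..b}"
    using tagged_partial_division_subset[of p] p D by (simp add: tagged_division_of_def)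
  note tpD = tagged_partial_division_ofD[OF tp]
  have meas: "snd i \<in> lmeasurable" if "i \<in> D" for i
    using tpD(4)[of "fst i" "snd i"] that by auto
  have neg: "negligible (snd i \<inter> snd j)" if ij': "i \<in> D" "j \<in> D" "i \<noteq> j" for i j
  proof -
    obtain x K y K' where ij: "i = (x, K)" "j = (y, K')"
      by fastforce
    obtain c d c' d' where K: "K = cbox c d" "K' = cbox c' d'"
      using tpD(4)[of x K] tpD(4)[of y K'] ij' ij by auto
    have "interior (K \<inter> K') = {}"
      using tpD(5)[of x K y K'] ij' ij by auto
    moreover obtain u v where uv: "K \<inter> K' = cbox u v"
      unfolding K Int_interval by blast
    ultimately have "box u v = {}"
      by simp
    then show ?thesis
      using ij uv negligible_interval(1)[of u v] by simp
  qed
  have "(\<Sum>(x,K)\<in>D. measure lborel K) = (\<Sum>i\<in>D. measure lebesgue (snd i))"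
    proof (rule sum.cong[OF refl])
    fix i assume "i \<in> D"
    then show "(case i of (x, K) \<Rightarrow> measure lborel K) = measure lebesgue (snd i)"
      using tpD(4)[of "fst i" "snd i"] by (auto simp: split_def)
  qed
  also have "\<dots> = measure lebesgue (\<Union>(snd ` D))"
    using tpD(1) neg
    by (intro measure_negligible_finite_Union_image[symmetric])
      (auto simp: pairwise_def meas)
  also have "\<dots> \<le> measure lebesgue U"
  proof (rule measure_mono_fmeasurable[OF _ _ U])
    show "\<Union>(snd ` D) \<in> sets lebesgue"
    proof (rule sets.finite_Union)
      show "snd ` D \<subseteq> sets lebesgue"
        using meas by (auto intro: fmeasurableD)
    qed (use tpD(1) in auto)
    show "\<Union>(snd ` D) \<subseteq> U"
      using DU by fastforce
  qed
  finally show ?thesis .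
qed

text \<open>On tags in the exceptional null set the Riemann sum is controlled by absolute continuity,
  elsewhere by differentiability.\<close>

lemma has_integral_abs_cont_on:
  fixes f :: "real \<Rightarrow> 'a::euclidean_space"
  assumes ac: "abs_cont_on f a b" and ab: "a \<le> b"
    and ae: "AE t in lebesgue. t \<in> {a..b} \<longrightarrow> (f has_vector_derivative f' t) (at t)"
  shows "(f' has_integral (f b - f a)) {a..b}"
proof -
  obtain N where N: "N \<in> null_sets lebesgue"
    "\<And>t. t \<in> {a..b} \<Longrightarrow> t \<notin> N \<Longrightarrow> (f has_vector_derivative f' t) (at t)"
    by (rule AE_E3[OF ae]) force
  have negN: "negligible N"
    using N(1) by (simp add: negligible_iff_null_sets)
  \<comment> \<open>\<open>f'\<close> is arbitrary on \<open>N\<close>. With the value 0 there, a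
    tag in \<open>N\<close> leaves only the increment of \<open>f\<close> to be estimated.\<close>
  define g where "g t = (if t \<in> N then 0 else f' t)" for t
  have "(g has_integral (f b - f a)) {a..b}"
    unfolding has_integral_real
  proof (intro allI impI)
    fix e :: real assume "e > 0"
    \<comment> \<open>The \<open>+ 1\<close> keeps the quotient meaningful when \<open>a = b\<close>
      and leaves the total differentiability error strictly below \<open>e / 2\<close>.\<close>
    define e' where "e' = e / 2 / (b - a + 1)"
    have e'0: "e' > 0" and "e' * (b - a + 1) = e / 2"
      using \<open>e > 0\<close> ab by (simp_all add: e'_def del: divide_divide_eq_left)
    then have e': "e' > 0" "e' * (b - a) < e / 2"
      by (simp_all add: distrib_left)
    obtain \<delta> where \<delta>: "\<delta> > 0"
      "\<forall>(D::(real \<times> real set) set) s t. finite D \<longrightarrow> (\<forall>i\<in>D. a \<le> s i \<and> s i \<le> t i \<and> t i \<le> b) \<longrightarrow>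
         (\<forall>i\<in>D. \<forall>j\<in>D. i \<noteq> j \<longrightarrow> t i \<le> s j \<or> t j \<le> s i) \<longrightarrow> (\<Sum>i\<in>D. t i - s i) < \<delta> \<longrightarrow>
         (\<Sum>i\<in>D. norm (f (t i) - f (s i))) < e / 2"
      using abs_cont_on_finite_intervals[OF ac half_gt_zero[OF \<open>e > 0\<close>]] by (elim exE conjE)
    \<comment> \<open>A gauge confined to \<open>U\<close> at tags in \<open>N\<close> gives those
      pieces a total length below \<delta>, the threshold from absolute continuity.\<close>
    obtain U where U: "open U" "N \<subseteq> U" "U - N \<in> lmeasurable" "emeasure lebesgue (U - N) < ennreal \<delta>"
      using sets_lebesgue_outer_open[OF null_setsD2[OF N(1)] \<delta>(1)] .
    have Um: "U \<in> lmeasurable"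
      using fmeasurable.Un[OF U(3) fmeasurableI_null_sets[OF N(1)]] U(2) by (simp add: Un_absorb2)
    have Ul: "measure lebesgue U < \<delta>"
    proof -
      have "emeasure lebesgue U = emeasure lebesgue (U - N)"
        using N(1) Um by (simp add: emeasure_Diff_null_set fmeasurableD)
      then show ?thesis
        using U(4) emeasure_eq_measure2[OF Um] ennreal_less_iff[OF measure_nonneg] by metis
    qed
    have "\<exists>d>0. (x \<in> N \<longrightarrow> ball x d \<subseteq> U) \<and> (x \<in> {a..b} - N \<longrightarrow>
        (\<forall>y. norm (y - x) < d \<longrightarrow> norm (f y - f x - (y - x) *\<^sub>R f' x) \<le> e' * norm (y - x)))" for x
    proof (cases "x \<in> N")
      case True
      then show ?thesis
        using U(1,2) openE by blast
    next
      case False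
      show ?thesis
      proof (cases "x \<in> {a..b}")
        case True
        then have "(f has_vector_derivative f' x) (at x)"
          using False N(2) by blast
        then show ?thesis
          using e'(1) False unfolding has_vector_derivative_def has_derivative_at_alt by auto
      qed (use False in \<open>auto intro: exI[of _ 1]\<close>)
    qed
    then obtain d where d': "\<And>x. d x > 0 \<and> (x \<in> N \<longrightarrow> ball x (d x) \<subseteq> U) \<and> (x \<in> {a..b} - N \<longrightarrow>
        (\<forall>y. norm (y - x) < d x \<longrightarrow> norm (f y - f x - (y - x) *\<^sub>R f' x) \<le> e' * norm (y - x)))"
      by metis
    have d: "\<And>x. d x > 0" "\<And>x. x \<in> N \<Longrightarrow> ball x (d x) \<subseteq> U"
      "\<And>x y. \<lbrakk>x \<in> {a..b}; x \<notin> N; norm (y - x) < d x\<rbrakk> \<Longrightarrow>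
         norm (f y - f x - (y - x) *\<^sub>R f' x) \<le> e' * norm (y - x)"
      using d' by blast+
    show "\<exists>\<gamma>. gauge \<gamma> \<and> (\<forall>p. p tagged_division_of {a..b} \<and> \<gamma> fine p \<longrightarrow>
        norm ((\<Sum>(x,K)\<in>p. measure lborel K *\<^sub>R g x) - (f b - f a)) < e)"
    proof (intro exI conjI allI impI)
      show "gauge (\<lambda>x. ball x (d x))"
        using d(1) gauge_ball_dependent by blast
      fix p assume "p tagged_division_of {a..b} \<and> (\<lambda>x. ball x (d x)) fine p"
      then have p: "p tagged_division_of {a..b}" and fine: "\<And>x K. (x, K) \<in> p \<Longrightarrow> K \<subseteq> ball x (d x)"
        by (auto simp: fine_def)
      note pD = tagged_division_ofD[OF p]
      have pK: "\<exists>u v. K = {u..v} \<and> u \<le> x \<and> x \<le> v \<and> a \<le> u \<and> v \<le> b \<and> Inf K = u \<and> Sup K = v" if "(x, K) \<in> p" for x K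
      proof -
        obtain u v where uv: "K = cbox u v"
          using pD(4) \<open>(x, K) \<in> p\<close> by blast
        then have "x \<in> {u..v}" "{u..v} \<subseteq> {a..b}"
          using pD(2,3)[OF that] by auto
        then show ?thesis
          using uv by auto
      qed
      \<comment> \<open>Degenerate intervals are left out: their terms vanish, and disjointness of
        interiors orders two intervals only if both have positive length.\<close>
      define D where "D = {i \<in> p. fst i \<in> N \<and> Inf (snd i) < Sup (snd i)}"
      define E where "E = {i \<in> p. fst i \<notin> N}"
      let ?t = "\<lambda>(x,K). measure lborel K *\<^sub>R g x - (f (Sup K) - f (Inf K))"
      have fin: "finite p" "finite D" "finite E"
        using pD(1) by (auto simp: D_def E_def)
      have "(\<Sum>(x,K)\<in>p. measure lborel K *\<^sub>R g x) - (f b - f a) = (\<Sum>i\<in>p. ?t i)"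
        by (simp add: additive_tagged_division_1[OF ab p, of f, symmetric] split_def sum_subtractf)
      also have "\<dots> = (\<Sum>i\<in>D \<union> E. ?t i)"
      proof (rule sum.mono_neutral_right[OF fin(1)])
        show "\<forall>i\<in>p - (D \<union> E). ?t i = 0"
        proof
          fix i assume i: "i \<in> p - (D \<union> E)"
          obtain x K where xK: "i = (x, K)" by fastforce
          obtain u v where "K = {u..v}" "u \<le> x" "x \<le> v" "Inf K = u" "Sup K = v"
            using pK i xK by blast
          then show "?t i = 0"
            using i xK by (cases "u = v") (auto simp: D_def E_def)
        qed
      qed (auto simp: D_def E_def)
      also have "\<dots> = (\<Sum>i\<in>D. ?t i) + (\<Sum>i\<in>E. ?t i)"
        by (rule sum.union_disjoint) (use fin in \<open>auto simp: D_def E_def\<close>)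
      finally have eq: "(\<Sum>(x,K)\<in>p. measure lborel K *\<^sub>R g x) - (f b - f a) = (\<Sum>i\<in>D. ?t i) + (\<Sum>i\<in>E. ?t i)" .
      have "norm (\<Sum>i\<in>D. ?t i) \<le> (\<Sum>i\<in>D. norm (f (Sup (snd i)) - f (Inf (snd i))))"
        by (rule sum_norm_le) (auto simp: D_def g_def norm_minus_commute)
      also have "\<dots> < e / 2"
      proof (rule \<delta>(2)[rule_format, OF fin(2)])
        show "a \<le> Inf (snd i) \<and> Inf (snd i) \<le> Sup (snd i) \<and> Sup (snd i) \<le> b" if "i \<in> D" for i
          using that pK[of "fst i" "snd i"] by (auto simp: D_def)
        show "Sup (snd i) \<le> Inf (snd j) \<or> Sup (snd j) \<le> Inf (snd i)" if ij: "i \<in> D" "j \<in> D" "i \<noteq> j" for i j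
        proof -
          obtain u v where uv: "snd i = {u..v}" "Inf (snd i) = u" "Sup (snd i) = v"
            using ij(1) pK[of "fst i" "snd i"] unfolding D_def by auto
          obtain u' v' where uv': "snd j = {u'..v'}" "Inf (snd j) = u'" "Sup (snd j) = v'"
            using ij(2) pK[of "fst j" "snd j"] unfolding D_def by auto
          have "(fst i, snd i) \<in> p" "(fst j, snd j) \<in> p" "(fst i, snd i) \<noteq> (fst j, snd j)"
            using ij by (auto simp: D_def)
          then have "interior (snd i) \<inter> interior (snd j) = {}"
            using pD(5) by blast
          then have "min v v' \<le> max u u'"
            using uv uv' by simp
          moreover have "u < v" "u' < v'"
            using ij uv uv' by (auto simp: D_def)
          ultimately have "v \<le> u' \<or> v' \<le> u"
            by linarith
          then show ?thesis
            using uv uv' by simp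
        qed
        have "(\<Sum>i\<in>D. Sup (snd i) - Inf (snd i)) = (\<Sum>(x,K)\<in>D. measure lborel K)"
        proof (rule sum.cong[OF refl])
          fix i assume "i \<in> D"
          then obtain x K where "i = (x, K)" "(x, K) \<in> p"
            by (cases i) (auto simp: D_def)
          then show "Sup (snd i) - Inf (snd i) = (case i of (x, K) \<Rightarrow> measure lborel K)"
            using pK[OF \<open>(x, K) \<in> p\<close>] by (elim exE conjE) simp
        qed
        also have "\<dots> \<le> measure lebesgue U"
        proof (rule sum_content_le_measure[OF p _ _ Um])
          fix x K assume "(x, K) \<in> D"
          then show "K \<subseteq> U"
            using fine[of x K] d(2)[of x] by (simp add: D_def)
        qed (auto simp: D_def)
        finally show "(\<Sum>i\<in>D. Sup (snd i) - Inf (snd i)) < \<delta>"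
          using Ul by simp
      qed
      finally have D: "norm (\<Sum>i\<in>D. ?t i) < e / 2" .
      have "norm (\<Sum>i\<in>E. ?t i) \<le> (\<Sum>i\<in>E. e' * (Sup (snd i) - Inf (snd i)))"
      proof (rule sum_norm_le)
        fix i assume "i \<in> E"
        then obtain x K where xK: "i = (x, K)" "(x, K) \<in> p" "x \<notin> N"
          by (cases i) (auto simp: E_def)
        obtain u v where K: "K = {u..v}" "u \<le> x" "x \<le> v" "a \<le> u" "v \<le> b" "Inf K = u" "Sup K = v"
          using pK[OF xK(2)] by blast
        have "u \<in> ball x (d x)" "v \<in> ball x (d x)"
          using fine[OF xK(2)] K by (auto simp del: mem_ball)
        then have 1: "norm (f u - f x - (u - x) *\<^sub>R f' x) \<le> e' * norm (u - x)"
          and 2: "norm (f v - f x - (v - x) *\<^sub>R f' x) \<le> e' * norm (v - x)"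
          using K xK by (auto intro!: d(3) simp del: real_norm_def simp: dist_norm norm_minus_commute)
        \<comment> \<open>Straddle estimate: the tag lies between the endpoints, so the errors at
          the two of them add up to \<open>e' * (v - u)\<close>.\<close>
        have "?t i = (f u - f x - (u - x) *\<^sub>R f' x) - (f v - f x - (v - x) *\<^sub>R f' x)"
          using K xK by (simp add: g_def algebra_simps)
        also have "norm \<dots> \<le> e' * norm (u - x) + e' * norm (v - x)"
          using 1 2 norm_triangle_ineq4 by (smt (verit))
        also have "\<dots> = e' * (v - u)"
          using K by (simp add: algebra_simps)
        finally show "norm (?t i) \<le> e' * (Sup (snd i) - Inf (snd i))"
          using K xK by simp
      qed
      also have "\<dots> \<le> (\<Sum>i\<in>p. e' * (Sup (snd i) - Inf (snd i)))"
      proof (rule sum_mono2[OF fin(1)])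
        fix i assume "i \<in> p - E"
        then show "0 \<le> e' * (Sup (snd i) - Inf (snd i))"
          using pK[of "fst i" "snd i"] e'(1) by auto
      qed (auto simp: E_def)
      also have "\<dots> = e' * (b - a)"
        using additive_tagged_division_1[OF ab p, of "\<lambda>x. x"] by (simp add: sum_distrib_left[symmetric] split_def)
      finally have "norm (\<Sum>i\<in>E. ?t i) < e / 2"
        using e'(2) by linarith
      then show "norm ((\<Sum>(x,K)\<in>p. measure lborel K *\<^sub>R g x) - (f b - f a)) < e"
        unfolding eq using D norm_triangle_ineq[of "\<Sum>i\<in>D. ?t i" "\<Sum>i\<in>E. ?t i"] by linarith
    qed
  qed
  then show ?thesis
    by (rule has_integral_spike[OF negN, rotated]) (auto simp: g_def)
qed

lemma abs_cont_on_norm_diff_le: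
  fixes f :: "real \<Rightarrow> 'a::euclidean_space"
  assumes "abs_cont_on f a b" "a \<le> b"
    and ae: "AE t in lebesgue. t \<in> {a..b} \<longrightarrow> (f has_vector_derivative f' t) (at t)"
    and le: "\<And>t. t \<in> {a..b} \<Longrightarrow> norm (f' t) \<le> g t"
    and g: "g integrable_on {a..b}"
  shows "norm (f b - f a) \<le> integral {a..b} g"
proof -
  have "(f' has_integral (f b - f a)) {a..b}"
    by (rule has_integral_abs_cont_on) fact+
  then show ?thesis
    using Henstock_Kurzweil_Integration.integral_norm_bound_integral[of f' "{a..b}" g] g le
    by (auto simp: has_integral_iff)
qed

subsection \<open>Products of horizontal steps\<close>

text \<open>Endpoint of the polygonal horizontal path that starts at the origin and follows left
  translates of the one-parameter subgroups through the listed vectors in turn.\<close>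

primrec hprod :: "(real ^ 'm::finite \<Rightarrow> real ^ 'm \<Rightarrow> real ^ 'k::finite) \<Rightarrow> (real ^ 'm) list \<Rightarrow> ('m, 'k) pt" where
  "hprod B [] = 0"
| "hprod B (x # xs) = gmul B (x, 0) (hprod B xs)"

abbreviation hlen :: "(real ^ 'm::finite) list \<Rightarrow> real" where
  "hlen xs \<equiv> sum_list (map norm xs)"

text \<open>Polygonal form of the CC distance to the origin; \<open>cc_dist_eq_hdist\<close>
  identifies the two. Only finite lists occur, so variations of a path become finite sums.\<close>

definition hdist :: "(real ^ 'm::finite \<Rightarrow> real ^ 'm \<Rightarrow> real ^ 'k::finite) \<Rightarrow> ('m, 'k) pt \<Rightarrow> real" where
  "hdist B p = Inf {hlen xs | xs. hprod B xs = p}"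

lemma hlen_nonneg: "0 \<le> hlen xs"
  by (rule sum_list_nonneg) auto

locale ideal_group =
  fixes B :: "real ^ 'm \<Rightarrow> real ^ 'm \<Rightarrow> real ^ 'k"
  assumes ideal: "ideal_carnot B"
begin

sublocale B: bounded_bilinear B
  using ideal bilinear_conv_bounded_bilinear by (auto simp: ideal_carnot_def step2_carnot_def)

declare B.zero_left [simp] B.zero_right [simp]

lemma skew: "B x y = - B y x"
  using ideal unfolding ideal_carnot_def step2_carnot_def by (elim conjE allE)

lemma B_self [simp]: "B x x = 0"
proof -
  have "B x x $ i = 0" for i
    using arg_cong[OF skew[of x x], of "\<lambda>v. v $ i"] by (simp only: vector_uminus_component equal_neg_zero)
  then show ?thesis
    by (simp add: vec_eq_iff)
qed

text \<open>Applied to the element \<open>(0, q)\<close>, fatness forces the first-layer summand to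
  vanish. The factor -2 absorbs the bracket normalisation and the swap of the arguments.\<close>

lemma B_surj:
  assumes "x \<noteq> 0"
  obtains w where "B x w = q"
proof -
  have "{(y, 0) + (0, 2 *\<^sub>R B w x) | y w. True} = (UNIV :: ('m, 'k) pt set)"
    using ideal assms unfolding ideal_carnot_def by (elim conjE allE impE)
  then have "(0 :: real ^ 'm, q) \<in> {(y, 0) + (0, 2 *\<^sub>R B w x) | y w. True}"
    by simp
  then obtain w where "q = 2 *\<^sub>R B w x"
    by auto
  then have "B x ((-2) *\<^sub>R w) = q"
    using skew[of x w] by (simp add: B.scaleR_right B.minus_right)
  then show ?thesis
    using that by blast
qed

text \<open>Fixed once by choice, so that later constants can be explicit expressions in it.\<close>

definition bnd :: real where
  "bnd = (SOME K. 0 < K \<and> (\<forall>x y. norm (B x y) \<le> norm x * norm y * K))"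

lemma bnd_pos: "0 < bnd" and norm_B_le: "norm (B x y) \<le> bnd * norm x * norm y"
proof -
  have "0 < bnd \<and> (\<forall>x y. norm (B x y) \<le> norm x * norm y * bnd)"
    unfolding bnd_def by (rule someI_ex) (use B.pos_bounded in blast)
  then show "0 < bnd" "norm (B x y) \<le> bnd * norm x * norm y"
    by (auto simp: mult_ac)
qed

section \<open>Group law and endpoints of polygons\<close>

lemma gmul_assoc: "gmul B (gmul B p q) r = gmul B p (gmul B q r)"
  by (simp add: gmul_def B.add_left B.add_right algebra_simps)

lemma gmul_0 [simp]: "gmul B 0 p = p" "gmul B p 0 = p"
  by (simp_all add: gmul_def)

lemma gmul_minus [simp]: "gmul B (- p) p = 0" "gmul B p (- p) = 0"
  by (simp_all add: gmul_def B.minus_left B.minus_right prod_eq_iff)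

lemma minus_gmul: "- gmul B p q = gmul B (- q) (- p)"
  using skew[of "fst q" "fst p"] by (simp add: gmul_def B.minus_left B.minus_right)

lemma hprod_append: "hprod B (xs @ ys) = gmul B (hprod B xs) (hprod B ys)"
  by (induction xs) (simp_all add: gmul_assoc)

lemma hprod_single: "hprod B [x] = (x, 0)"
  by simp

lemma hprod_rev: "hprod B (rev (map uminus xs)) = - hprod B xs"
  by (induction xs) (simp_all add: hprod_append minus_gmul)

lemma hlen_rev: "hlen (rev (map uminus xs)) = hlen xs"
  by (induction xs) simp_all

lemma hprod_upt:
  "hprod B (map a [0..<n]) = (\<Sum>i<n. a i, \<Sum>i<n. B (\<Sum>j<i. a j) (a i))"
  by (induction n) (simp_all add: hprod_append gmul_def zero_prod_def)

lemma hlen_upt: "hlen (map a [0..<n]) = (\<Sum>i<n. norm (a i))"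
  by (induction n) auto

lemma hprod_replicate: "hprod B (replicate n x) = (real n *\<^sub>R x, 0)"
  by (induction n) (simp_all add: gmul_def B.scaleR_right zero_prod_def algebra_simps)

text \<open>Multiples of one horizontal vector lie in a one-parameter subgroup, so cutting each step
  into \<open>n\<close> equal ones changes neither endpoint nor length. Every step becomes a small
  fraction of the whole length, as \<open>spread\<close> requires.\<close>

lemma refine_list:
  assumes "0 < n"
  obtains ys where "hprod B ys = hprod B xs" "hlen ys = hlen xs" "\<And>y. y \<in> set ys \<Longrightarrow> norm y \<le> hlen xs / real n"
proof
  let ?ys = "concat (map (\<lambda>x. replicate n (x /\<^sub>R real n)) xs)"
  show "hprod B ?ys = hprod B xs"
    using assms by (induction xs) (simp_all add: hprod_append hprod_replicate)
  show "hlen ?ys = hlen xs"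
    using assms by (induction xs) (simp_all add: sum_list_replicate)
  show "norm y \<le> hlen xs / real n" if y: "y \<in> set ?ys" for y
  proof -
    obtain x where x: "x \<in> set xs" "y = x /\<^sub>R real n"
      using y by auto
    have "norm x \<le> hlen xs"
      using x by (intro member_le_sum_list) auto
    then show ?thesis
      using x assms by (simp add: divide_simps)
  qed
qed

text \<open>A commutator of two horizontal elements is vertical and bilinear in them. Balancing both
  factors at size \<open>sqrt (norm q)\<close> gives a path with length of that order.\<close>

lemma vertical_list:
  "\<exists>C>0. \<forall>q. \<exists>xs. hprod B xs = (0, q) \<and> hlen xs \<le> C * sqrt (norm q)"
proof -
  obtain x0 :: "real ^ 'm" where x0: "norm x0 = 1"
    by (rule vector_choose_size[of 1]) auto
  have lin: "linear (B x0)"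
    by (rule bounded_linear.linear[OF B.bounded_linear_right])
  have "surj (B x0)"
    unfolding surj_def
  proof
    fix q
    show "\<exists>w. q = B x0 w"
      by (rule B_surj[of x0 q]) (use x0 in auto)
  qed
  \<comment> \<open>A linear right inverse is bounded, which makes the length estimate uniform in
    \<open>q\<close>.\<close>
  then obtain g where g: "linear g" "\<And>q. B x0 (g q) = q"
    using linear_surjective_right_inverse[OF lin] by (auto simp: fun_eq_iff)
  obtain C where C: "0 < C" "\<And>q. norm (g q) \<le> norm q * C"
    using bounded_linear.pos_bounded[OF linear_conv_bounded_linear[THEN iffD1, OF g(1)]] by blast
  show ?thesis
  proof (intro exI[of _ "2 + C"] conjI allI)
    show "0 < 2 + C" using C by simp
    show "\<exists>xs. hprod B xs = (0, q) \<and> hlen xs \<le> (2 + C) * sqrt (norm q)" for q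
    proof (cases "q = 0")
      case True
      then show ?thesis by (intro exI[of _ "[]"]) (simp add: zero_prod_def)
    next
      case False
      define s where "s = sqrt (norm q)"
      have s: "s > 0" "s * s = norm q"
        using False by (simp_all add: s_def)
      \<comment> \<open>The factors \<open>s\<close> and \<open>1 / (2 * s)\<close> cancel against
        the 2 of the commutator, while both vectors have norm at most a constant times
        \<open>s\<close>.\<close>
      define x y where "x = s *\<^sub>R x0" and "y = (1 / (2 * s)) *\<^sub>R g q"
      have Bxy: "2 *\<^sub>R B x y = q"
        using s g by (simp add: x_def y_def B.scaleR_left B.scaleR_right)
      have "hprod B [x, y, - x, - y] = (0, 2 *\<^sub>R B x y)"
        using skew[of y x] by (simp add: gmul_def B.minus_right B.minus_left B.add_right B.diff_right scaleR_2 zero_prod_def)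
      moreover have "norm y \<le> C * norm q / (2 * s)"
        using C(2)[of q] s by (simp add: y_def divide_simps mult.commute)
      then have "norm y \<le> C * s / 2"
        using s(1) by (simp add: s(2)[symmetric])
      then have "hlen [x, y, - x, - y] \<le> (2 + C) * s"
        using s(1) by (simp add: x_def x0 algebra_simps)
      ultimately show ?thesis
        unfolding s_def[symmetric] Bxy by blast
    qed
  qed
qed

text \<open>One horizontal step supplies the first coordinate and a vertical list the second; the
  twist \<open>B (fst p) 0\<close> vanishes.\<close>

lemma ball_box_list:
  "\<exists>C>0. \<forall>p. \<exists>xs. hprod B xs = p \<and> hlen xs \<le> C * (norm (fst p) + sqrt (norm (snd p)))"
proof -
  obtain C where C: "0 < C" "\<And>q. \<exists>xs. hprod B xs = (0, q) \<and> hlen xs \<le> C * sqrt (norm q)"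
    using vertical_list by blast
  show ?thesis
  proof (intro exI[of _ "1 + C"] conjI allI)
    show "0 < 1 + C" using C by simp
    fix p :: "('m, 'k) pt"
    obtain xs where xs: "hprod B xs = (0, snd p)" "hlen xs \<le> C * sqrt (norm (snd p))"
      using C(2) by blast
    have "hprod B (fst p # xs) = p"
      using xs by (simp add: gmul_def)
    moreover have "hlen (fst p # xs) \<le> (1 + C) * (norm (fst p) + sqrt (norm (snd p)))"
    proof -
      have "0 \<le> sqrt (norm (snd p))" "0 \<le> C * norm (fst p)"
        using C(1) by simp_all
      then show ?thesis
        using xs(2) unfolding list.map sum_list.Cons distrib_left distrib_right by linarith
    qed
    ultimately show "\<exists>xs. hprod B xs = p \<and> hlen xs \<le> (1 + C) * (norm (fst p) + sqrt (norm (snd p)))"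
      by blast
  qed
qed

lemma ex_hprod: "\<exists>xs. hprod B xs = p"
proof -
  obtain C where "\<forall>p. \<exists>xs. hprod B xs = p \<and> hlen xs \<le> C * (norm (fst p) + sqrt (norm (snd p)))"
    using ball_box_list by blast
  from spec[OF this, of p] show ?thesis
    by (elim exE conjE) (rule exI)
qed

section \<open>The polygonal distance to the origin\<close>

lemma hdist_le: "hprod B xs = p \<Longrightarrow> hdist B p \<le> hlen xs"
  unfolding hdist_def by (rule cInf_lower) (auto intro!: bdd_belowI[of _ 0] hlen_nonneg)

lemma hdist_approx:
  assumes "hdist B p < r"
  shows "\<exists>xs. hprod B xs = p \<and> hlen xs < r"
proof -
  have "{hlen xs | xs. hprod B xs = p} \<noteq> {}"
    using ex_hprod by simp
  from cInf_lessD[OF this assms[unfolded hdist_def]] show ?thesis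
    by auto
qed

lemma hdist_nonneg: "0 \<le> hdist B p"
proof (rule ccontr)
  assume "\<not> 0 \<le> hdist B p"
  then obtain xs where "hprod B xs = p" "hlen xs < 0"
    using hdist_approx[of p 0] by auto
  then show False
    using hlen_nonneg[of xs] by simp
qed

lemma hdist_gmul_le: "hdist B (gmul B p q) \<le> hdist B p + hdist B q"
proof (rule field_le_epsilon)
  fix e :: real assume "e > 0"
  obtain xs where xs: "hprod B xs = p" "hlen xs < hdist B p + e / 2"
    using hdist_approx[of p "hdist B p + e / 2"] \<open>e > 0\<close> by auto
  obtain ys where ys: "hprod B ys = q" "hlen ys < hdist B q + e / 2"
    using hdist_approx[of q "hdist B q + e / 2"] \<open>e > 0\<close> by auto
  have "hdist B (gmul B p q) \<le> hlen (xs @ ys)"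
    using xs ys by (intro hdist_le) (simp add: hprod_append)
  then show "hdist B (gmul B p q) \<le> hdist B p + hdist B q + e"
    using xs ys by simp
qed

lemma hdist_minus: "hdist B (- p) = hdist B p"
proof -
  have "hdist B (- p) \<le> hdist B p" for p
  proof (rule field_le_epsilon)
    fix e :: real assume "e > 0"
    then obtain xs where xs: "hprod B xs = p" "hlen xs < hdist B p + e"
      using hdist_approx[of p "hdist B p + e"] by auto
    then show "hdist B (- p) \<le> hdist B p + e"
      using hdist_le[OF hprod_rev[of xs]] hlen_rev[of xs] by simp
  qed
  from this[of p] this[of "- p"] show ?thesis by simp
qed

lemma hdist_horizontal: "hdist B (h, 0) \<le> norm h"
  using hdist_le[OF hprod_single] by simp

lemma ball_box:
  "\<exists>C>0. \<forall>p. hdist B p \<le> C * (norm (fst p) + sqrt (norm (snd p)))"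
proof -
  obtain C where C: "0 < C" "\<And>p. \<exists>xs. hprod B xs = p \<and> hlen xs \<le> C * (norm (fst p) + sqrt (norm (snd p)))"
    using ball_box_list by blast
  have "hdist B p \<le> C * (norm (fst p) + sqrt (norm (snd p)))" for p
  proof -
    obtain xs where "hprod B xs = p" "hlen xs \<le> C * (norm (fst p) + sqrt (norm (snd p)))"
      using C(2) by blast
    then show ?thesis
      using hdist_le[of xs p] by linarith
  qed
  then show ?thesis
    using C(1) by blast
qed

text \<open>By the triangle inequality the change from \<open>p\<close> to \<open>q\<close> is at
  most \<open>hdist B (gmul B (- p) q)\<close>, and the ball-box bound for this tends to 0.\<close>

lemma continuous_hdist: "isCont (hdist B) p"
proof -
  obtain C where C: "0 < C" "\<And>p. hdist B p \<le> C * (norm (fst p) + sqrt (norm (snd p)))"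
    using ball_box by blast
  define n where "n q = C * (norm (fst q - fst p) + sqrt (norm (snd q - snd p - B (fst p) (fst q))))" for q
  have n: "hdist B (gmul B (- p) q) \<le> n q" for q
    using C(2)[of "gmul B (- p) q"] by (simp add: gmul_def n_def B.minus_left)
  have "((\<lambda>q. B (fst p) (fst q)) \<longlongrightarrow> B (fst p) (fst p)) (at p)"
    by (intro B.tendsto tendsto_const tendsto_fst tendsto_ident_at)
  then have "(n \<longlongrightarrow> C * (norm (fst p - fst p) + sqrt (norm (snd p - snd p - B (fst p) (fst p))))) (at p)"
    unfolding n_def by (intro tendsto_intros)
  then have lim: "(n \<longlongrightarrow> 0) (at p)"
    by simp
  have le: "\<bar>hdist B q - hdist B p\<bar> \<le> n q" for q
  proof -
    have "hdist B q \<le> hdist B p + hdist B (gmul B (- p) q)"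
      using hdist_gmul_le[of p "gmul B (- p) q"] by (simp flip: gmul_assoc)
    moreover have "hdist B p \<le> hdist B q + hdist B (- gmul B (- p) q)"
      using hdist_gmul_le[of q "- gmul B (- p) q"] by (simp add: minus_gmul flip: gmul_assoc)
    ultimately show ?thesis
      using n[of q] hdist_minus[of "gmul B (- p) q"] by linarith
  qed
  have "((\<lambda>q. \<bar>hdist B q - hdist B p\<bar>) \<longlongrightarrow> 0) (at p)"
  proof (rule tendsto_sandwich[OF _ _ tendsto_const lim])
    show "\<forall>\<^sub>F q in at p. \<bar>hdist B q - hdist B p\<bar> \<le> n q"
      using le by (intro always_eventually allI)
  qed simp
  then have "((\<lambda>q. hdist B q - hdist B p) \<longlongrightarrow> 0) (at p)"
    by (rule tendsto_rabs_zero_cancel)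
  then show ?thesis
    unfolding isCont_def by (rule LIM_zero_cancel)
qed

end

subsection \<open>Horizontal curves and polygonal paths\<close>

lemma abs_cont_on_bounded_linear:
  assumes T: "bounded_linear T" and f: "abs_cont_on f a b"
  shows "abs_cont_on (\<lambda>t. T (f t)) a b"
  unfolding abs_cont_on_def
proof (intro allI impI)
  fix e :: real assume "e > 0"
  obtain K where K: "0 < K" "\<And>x. norm (T x) \<le> norm x * K"
    using bounded_linear.pos_bounded[OF T] by blast
  have TK: "dist (T x) (T y) \<le> K * dist x y" for x y
    using K(2)[of "x - y"] by (simp add: dist_norm bounded_linear.linear[OF T] linear_diff mult.commute)
  have "e / K > 0"
    using \<open>e > 0\<close> K(1) by simp
  then obtain \<delta> where \<delta>: "\<delta> > 0"
    "\<And>(n::nat) (s::nat\<Rightarrow>real) t. (\<forall>i<n. a \<le> s i \<and> s i \<le> t i \<and> t i \<le> b)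
      \<and> (\<forall>i<n. \<forall>j<n. i \<noteq> j \<longrightarrow> t i \<le> s j \<or> t j \<le> s i)
      \<and> (\<Sum>i<n. t i - s i) < \<delta> \<Longrightarrow> (\<Sum>i<n. dist (f (t i)) (f (s i))) < e / K"
    using f unfolding abs_cont_on_def by blast
  show "\<exists>\<delta>>0. \<forall>(n::nat) (s::nat\<Rightarrow>real) t.
      (\<forall>i<n. a \<le> s i \<and> s i \<le> t i \<and> t i \<le> b)
      \<and> (\<forall>i<n. \<forall>j<n. i \<noteq> j \<longrightarrow> t i \<le> s j \<or> t j \<le> s i)
      \<and> (\<Sum>i<n. t i - s i) < \<delta>
      \<longrightarrow> (\<Sum>i<n. dist (T (f (t i))) (T (f (s i)))) < e"
  proof (intro exI[of _ \<delta>] conjI allI impI \<delta>(1))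
    fix n :: nat and s t :: "nat \<Rightarrow> real"
    assume *: "(\<forall>i<n. a \<le> s i \<and> s i \<le> t i \<and> t i \<le> b)
      \<and> (\<forall>i<n. \<forall>j<n. i \<noteq> j \<longrightarrow> t i \<le> s j \<or> t j \<le> s i) \<and> (\<Sum>i<n. t i - s i) < \<delta>"
    have "(\<Sum>i<n. dist (T (f (t i))) (T (f (s i)))) \<le> K * (\<Sum>i<n. dist (f (t i)) (f (s i)))"
      unfolding sum_distrib_left by (rule sum_mono) (rule TK)
    also have "\<dots> < e"
      using \<delta>(2)[OF *] K(1) by (simp add: field_simps)
    finally show "(\<Sum>i<n. dist (T (f (t i))) (T (f (s i)))) < e" .
  qed
qed

lemma abs_cont_on_lipschitz:
  assumes "0 \<le> M" "\<And>s t. dist (f t) (f s) \<le> M * \<bar>t - s\<bar>"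
  shows "abs_cont_on f a b"
  unfolding abs_cont_on_def
proof (intro allI impI)
  fix e :: real assume "e > 0"
  show "\<exists>\<delta>>0. \<forall>(n::nat) (s::nat\<Rightarrow>real) t.
      (\<forall>i<n. a \<le> s i \<and> s i \<le> t i \<and> t i \<le> b)
      \<and> (\<forall>i<n. \<forall>j<n. i \<noteq> j \<longrightarrow> t i \<le> s j \<or> t j \<le> s i)
      \<and> (\<Sum>i<n. t i - s i) < \<delta>
      \<longrightarrow> (\<Sum>i<n. dist (f (t i)) (f (s i))) < e"
  proof (intro exI[of _ "e / (M + 1)"] conjI allI impI)
    show "0 < e / (M + 1)" using \<open>e > 0\<close> assms(1) by simp
    fix n :: nat and s t :: "nat \<Rightarrow> real"
    assume *: "(\<forall>i<n. a \<le> s i \<and> s i \<le> t i \<and> t i \<le> b)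
      \<and> (\<forall>i<n. \<forall>j<n. i \<noteq> j \<longrightarrow> t i \<le> s j \<or> t j \<le> s i) \<and> (\<Sum>i<n. t i - s i) < e / (M + 1)"
    have "(\<Sum>i<n. dist (f (t i)) (f (s i))) \<le> (\<Sum>i<n. (M + 1) * (t i - s i))"
    proof (rule sum_mono)
      fix i assume "i \<in> {..<n}"
      then have "\<bar>t i - s i\<bar> = t i - s i" "0 \<le> t i - s i"
        using * by auto
      then show "dist (f (t i)) (f (s i)) \<le> (M + 1) * (t i - s i)"
        using assms(2)[of "t i" "s i"] by (simp add: distrib_right)
    qed
    also have "\<dots> = (M + 1) * (\<Sum>i<n. t i - s i)"
      by (simp only: sum_distrib_left)
    also have "\<dots> < e"
      using * assms(1) by (simp add: pos_less_divide_eq mult.commute)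
    finally show "(\<Sum>i<n. dist (f (t i)) (f (s i))) < e" .
  qed
qed

lemma abs_cont_on_uniform:
  assumes "abs_cont_on f a b" "e > 0"
  shows "\<exists>\<delta>>0. \<forall>s t. a \<le> s \<longrightarrow> s \<le> t \<longrightarrow> t \<le> b \<longrightarrow> t - s < \<delta> \<longrightarrow> dist (f t) (f s) < e"
proof -
  obtain \<delta> where \<delta>: "\<delta> > 0"
    "\<And>(n::nat) (s::nat\<Rightarrow>real) t. (\<forall>i<n. a \<le> s i \<and> s i \<le> t i \<and> t i \<le> b)
      \<and> (\<forall>i<n. \<forall>j<n. i \<noteq> j \<longrightarrow> t i \<le> s j \<or> t j \<le> s i)
      \<and> (\<Sum>i<n. t i - s i) < \<delta> \<Longrightarrow> (\<Sum>i<n. dist (f (t i)) (f (s i))) < e"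
    using assms unfolding abs_cont_on_def by blast
  show ?thesis
  proof (intro exI[of _ \<delta>] conjI allI impI \<delta>(1))
    fix s t assume "a \<le> s" "s \<le> t" "t \<le> b" "t - s < \<delta>"
    then show "dist (f t) (f s) < e"
      using \<delta>(2)[of "Suc 0" "\<lambda>_. s" "\<lambda>_. t"] by simp
  qed
qed

context ideal_group
begin

lemma horizontal_velocity:
  "(\<Sum>i\<in>UNIV. u $ i *\<^sub>R (axis i 1, B x (axis i 1))) = (u, B x u)"
proof -
  have u: "(\<Sum>i\<in>UNIV. u $ i *\<^sub>R axis i 1) = u"
    using basis_expansion[of u] by (simp add: scalar_mult_eq_scaleR)
  have "(\<Sum>i\<in>UNIV. u $ i *\<^sub>R B x (axis i 1)) = B x (\<Sum>i\<in>UNIV. u $ i *\<^sub>R axis i 1)"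
    by (simp add: B.sum_right B.scaleR_right)
  then show ?thesis
    using u by (simp add: prod_eq_iff fst_sum snd_sum)
qed

lemma hprod_upt_translate:
  "gmul B p (hprod B (map a [0..<n])) =
    p + (\<Sum>i<n. (a i, B (fst p + (\<Sum>j<i. a j)) (a i)))"
  unfolding hprod_upt gmul_def
  by (simp add: prod_eq_iff fst_sum snd_sum B.add_left B.sum_right sum.distrib)

text \<open>The increments of the horizontal part at equally spaced times form a polygon no longer
  than the curve, with the right horizontal endpoint. Its vertical error is of the order of the
  oscillation on one time step times the length, and a vertical list repairs it.\<close>

lemma list_of_horiz_curve:
  assumes hc: "horiz_curve B \<gamma> u p q" and "e > 0"
  shows "\<exists>xs. gmul B p (hprod B xs) = q \<and> hlen xs \<le> integral {0..1} (\<lambda>t. norm (u t)) + e"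
proof -
  define x where "x t = fst (\<gamma> t)" for t
  define y where "y t = snd (\<gamma> t)" for t
  define l where "l = integral {0..1} (\<lambda>t. norm (u t))"
  have ac: "abs_cont_on \<gamma> 0 1" and ends: "\<gamma> 0 = p" "\<gamma> 1 = q"
    and int: "(\<lambda>t. norm (u t)) integrable_on {0..1}"
    and der: "AE t in lebesgue. t \<in> {0..1} \<longrightarrow> (\<gamma> has_vector_derivative (u t, B (x t) (u t))) (at t)"
    using hc unfolding horiz_curve_def horizontal_velocity x_def by auto
  have l0: "0 \<le> l"
    unfolding l_def by (rule integral_nonneg[OF int]) simp
  have ints: "(\<lambda>t. norm (u t)) integrable_on {s..r}" if "0 \<le> s" "r \<le> 1" for s r
    by (rule integrable_on_subinterval[OF int]) (use that in auto)
  have fund: "norm (T (\<gamma> r) - T (\<gamma> s)) \<le> M * integral {s..r} (\<lambda>t. norm (u t))"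
    if T: "bounded_linear T" and sr: "0 \<le> s" "s \<le> r" "r \<le> 1"
      and M: "\<And>t. s \<le> t \<Longrightarrow> t \<le> r \<Longrightarrow> norm (T (u t, B (x t) (u t))) \<le> M * norm (u t)"
    for T :: "('m, 'k) pt \<Rightarrow> 'c::euclidean_space" and s r M
  proof -
    have "norm (T (\<gamma> r) - T (\<gamma> s)) \<le> integral {s..r} (\<lambda>t. M * norm (u t))"
    proof (rule abs_cont_on_norm_diff_le[where f = "\<lambda>t. T (\<gamma> t)" and f' = "\<lambda>t. T (u t, B (x t) (u t))"])
      show "abs_cont_on (\<lambda>t. T (\<gamma> t)) s r"
        using sr abs_cont_on_subinterval[OF abs_cont_on_bounded_linear[OF T ac]] by auto
      show "AE t in lebesgue. t \<in> {s..r} \<longrightarrow>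
          ((\<lambda>t. T (\<gamma> t)) has_vector_derivative T (u t, B (x t) (u t))) (at t)"
        using der by (rule AE_mp) (use sr bounded_linear.has_vector_derivative[OF T] in \<open>auto intro!: AE_I2\<close>)
      show "(\<lambda>t. M * norm (u t)) integrable_on {s..r}"
        using integrable_cmul[OF ints[OF sr(1,3)], of M] by simp
    qed (use sr M in auto)
    then show ?thesis
      by simp
  qed
  have fund1: "norm (x r - x s) \<le> integral {s..r} (\<lambda>t. norm (u t))" if "0 \<le> s" "s \<le> r" "r \<le> 1" for s r
    using fund[OF bounded_linear_fst that, of 1] by (simp add: x_def)
  \<comment> \<open>Subtracting \<open>B (x s)\<close> freezes the horizontal position at time
    \<open>s\<close>. The derivative becomes \<open>B (x t - x s) (u t)\<close>, which is controlled
    by the oscillation \<eta>.\<close>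
  have fund2: "norm (y r - y s - B (x s) (x r - x s)) \<le> bnd * \<eta> * integral {s..r} (\<lambda>t. norm (u t))"
    if sr: "0 \<le> s" "s \<le> r" "r \<le> 1" and \<eta>: "\<And>t. s \<le> t \<Longrightarrow> t \<le> r \<Longrightarrow> norm (x t - x s) \<le> \<eta>" for s r \<eta>
  proof -
    let ?T = "\<lambda>v::('m, 'k) pt. snd v - B (x s) (fst v)"
    have "bounded_linear ?T"
      by (intro bounded_linear_sub bounded_linear_snd bounded_linear_compose[OF B.bounded_linear_right] bounded_linear_fst)
    moreover have "norm (?T (u t, B (x t) (u t))) \<le> bnd * \<eta> * norm (u t)" if "s \<le> t" "t \<le> r" for t
    proof -
      have "?T (u t, B (x t) (u t)) = B (x t - x s) (u t)"
        by (simp add: B.diff_left)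
      also have "norm \<dots> \<le> bnd * norm (x t - x s) * norm (u t)"
        by (rule norm_B_le)
      also have "\<dots> \<le> bnd * \<eta> * norm (u t)"
        using \<eta>[OF that] bnd_pos by (intro mult_right_mono mult_left_mono) auto
      finally show ?thesis .
    qed
    ultimately have "norm (?T (\<gamma> r) - ?T (\<gamma> s)) \<le> bnd * \<eta> * integral {s..r} (\<lambda>t. norm (u t))"
      using fund sr by blast
    then show ?thesis
      by (simp add: x_def y_def B.diff_right algebra_simps)
  qed
  obtain C where C: "0 < C" "\<And>q. \<exists>xs. hprod B xs = (0, q) \<and> hlen xs \<le> C * sqrt (norm q)"
    using vertical_list by blast
  \<comment> \<open>Chosen so that repairing a vertical error of size
    \<open>bnd * \<eta> * l\<close> costs at most \<open>e\<close> after the square root in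
    \<open>vertical_list\<close>; \<open>l + 1\<close> avoids a zero denominator.\<close>
  define \<eta> where "\<eta> = (e / C)\<^sup>2 / (bnd * (l + 1))"
  have \<eta>: "\<eta> > 0" "bnd * \<eta> * l \<le> (e / C)\<^sup>2"
  proof -
    show "\<eta> > 0"
      using \<open>e > 0\<close> C(1) bnd_pos l0 by (simp add: \<eta>_def)
    then have "bnd * \<eta> * l \<le> bnd * \<eta> * (l + 1)"
      using bnd_pos by simp
    also have "\<dots> = (e / C)\<^sup>2"
      using bnd_pos l0 by (simp add: \<eta>_def)
    finally show "bnd * \<eta> * l \<le> (e / C)\<^sup>2" .
  qed
  obtain \<delta> where \<delta>: "\<delta> > 0" "\<And>s t. \<lbrakk>0 \<le> s; s \<le> t; t \<le> 1; t - s < \<delta>\<rbrakk> \<Longrightarrow> dist (\<gamma> t) (\<gamma> s) < \<eta>"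
    using abs_cont_on_uniform[OF ac \<eta>(1)] by blast
  obtain N where N: "inverse (real (Suc N)) < \<delta>"
    using reals_Archimedean[OF \<delta>(1)] by blast
  define n where "n = Suc N"
  have n: "0 < n" "1 / real n < \<delta>"
    using N by (auto simp: n_def inverse_eq_divide)
  define T where "T i = real i / real n" for i
  have T: "0 \<le> T i" "T i \<le> T (Suc i)" "T (Suc i) \<le> 1" "T (Suc i) - T i < \<delta>" if "i < n" for i
    using that n by (auto simp: T_def divide_simps)
  have T01: "T 0 = 0" "T n = 1"
    using n by (auto simp: T_def)
  define a where "a i = x (T (Suc i)) - x (T i)" for i
  have xT: "x (T i) = fst p + (\<Sum>j<i. a j)" for i
    unfolding a_def using sum_lessThan_telescope[of "\<lambda>j. x (T j)" i] ends T01 by (simp add: x_def)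
  have tele: "(\<Sum>i<n. integral {T i..T (Suc i)} (\<lambda>t. norm (u t))) = l"
  proof -
    have "integral {T i..T (Suc i)} (\<lambda>t. norm (u t)) =
        integral {0..T (Suc i)} (\<lambda>t. norm (u t)) - integral {0..T i} (\<lambda>t. norm (u t))" if "i < n" for i
      using Henstock_Kurzweil_Integration.integral_combine[where a = 0 and c = "T i" and b = "T (Suc i)" and f = "\<lambda>t. norm (u t)"] T[OF that] ints by auto
    then have "(\<Sum>i<n. integral {T i..T (Suc i)} (\<lambda>t. norm (u t))) =
        (\<Sum>i<n. integral {0..T (Suc i)} (\<lambda>t. norm (u t)) - integral {0..T i} (\<lambda>t. norm (u t)))"
      by simp
    also have "\<dots> = l"
      using sum_lessThan_telescope[of "\<lambda>i. integral {0..T i} (\<lambda>t. norm (u t))" n] by (simp add: T01 l_def)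
    finally show ?thesis .
  qed
  have len: "hlen (map a [0..<n]) \<le> l"
    unfolding hlen_upt tele[symmetric] a_def by (rule sum_mono) (use T fund1 in auto)
  define err where "err = snd q - snd (gmul B p (hprod B (map a [0..<n])))"
  have e1: "err = (\<Sum>i<n. y (T (Suc i)) - y (T i) - B (x (T i)) (a i))"
  proof -
    have "(\<Sum>i<n. y (T (Suc i)) - y (T i)) = snd q - snd p"
      using sum_lessThan_telescope[of "\<lambda>i. y (T i)" n] ends by (simp add: T01 y_def)
    then show ?thesis
      unfolding err_def hprod_upt_translate xT by (simp add: sum_subtractf snd_sum)
  qed
  have "norm err \<le> (\<Sum>i<n. bnd * \<eta> * integral {T i..T (Suc i)} (\<lambda>t. norm (u t)))"
    unfolding e1
  proof (rule sum_norm_le)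
    fix i assume "i \<in> {..<n}"
    then have i: "i < n" by simp
    show "norm (y (T (Suc i)) - y (T i) - B (x (T i)) (a i))
        \<le> bnd * \<eta> * integral {T i..T (Suc i)} (\<lambda>t. norm (u t))"
      unfolding a_def
    proof (rule fund2[OF T(1-3)[OF i]])
      fix t assume t: "T i \<le> t" "t \<le> T (Suc i)"
      then have "dist (\<gamma> t) (\<gamma> (T i)) < \<eta>"
        using T[OF i] by (intro \<delta>(2)) auto
      then show "norm (x t - x (T i)) \<le> \<eta>"
        using dist_fst_le[of "\<gamma> t" "\<gamma> (T i)"] by (simp add: x_def dist_norm)
    qed
  qed
  also have "\<dots> = bnd * \<eta> * l"
    by (simp add: sum_distrib_left[symmetric] tele)
  finally have "norm err \<le> (e / C)\<^sup>2"
    using \<eta>(2) by simp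
  then have sq: "sqrt (norm err) \<le> e / C"
    using \<open>e > 0\<close> C(1) by (intro real_le_lsqrt) auto
  obtain vs where vs: "hprod B vs = (0, err)" "hlen vs \<le> C * sqrt (norm err)"
    using C(2) by blast
  show ?thesis
  proof (intro exI conjI)
    have "fst (gmul B p (hprod B (map a [0..<n]))) = fst q"
      using xT[of n] ends T01 unfolding hprod_upt_translate by (simp add: fst_sum x_def)
    then show "gmul B p (hprod B (map a [0..<n] @ vs)) = q"
      unfolding hprod_append gmul_assoc[symmetric] vs(1)
      by (simp add: gmul_def[of B "gmul B p _"] err_def prod_eq_iff)
    have "C * sqrt (norm err) \<le> e"
      using sq C(1) by (simp add: field_simps)
    then show "hlen (map a [0..<n] @ vs) \<le> integral {0..1} (\<lambda>t. norm (u t)) + e"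
      using len vs(2) unfolding l_def by simp
  qed
qed

text \<open>Step \<open>i\<close> is run at constant velocity from time \<open>i / n\<close> to time
  \<open>(i + 1) / n\<close>.\<close>

lemma horiz_curve_of_steps:
  fixes a :: "nat \<Rightarrow> real ^ 'm"
  assumes n: "0 < n"
  obtains \<gamma> u where "horiz_curve B \<gamma> u p (gmul B p (hprod B (map a [0..<n])))"
    "integral {0..1} (\<lambda>t. norm (u t)) = (\<Sum>i<n. norm (a i))"
proof -
  define cl where "cl z = max 0 (min 1 z)" for z :: real
  define x where "x i = fst p + (\<Sum>j<i. a j)" for i
  define w where "w i = (a i, B (x i) (a i))" for i
  \<comment> \<open>A sum of clamped ramps, each moving in direction \<open>w i\<close> only while
    step \<open>i\<close> is active. It is Lipschitz on the whole line without any gluing, hence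
    absolutely continuous.\<close>
  define \<gamma> where "\<gamma> t = p + (\<Sum>i<n. cl (real n * t - real i) *\<^sub>R w i)" for t
  define u where "u t = real n *\<^sub>R a (nat \<lfloor>real n * t\<rfloor>)" for t
  define M where "M = (\<Sum>i<n. real n * norm (w i))"
  have lip: "dist (\<gamma> t) (\<gamma> s) \<le> M * \<bar>t - s\<bar>" for s t
  proof -
    have "dist (\<gamma> t) (\<gamma> s) = norm (\<Sum>i<n. (cl (real n * t - real i) - cl (real n * s - real i)) *\<^sub>R w i)"
      by (simp add: \<gamma>_def dist_norm sum_subtractf scaleR_diff_left)
    also have "\<dots> \<le> (\<Sum>i<n. real n * \<bar>t - s\<bar> * norm (w i))"
    proof (rule sum_norm_le)
      fix i
      have "\<bar>cl z - cl z'\<bar> \<le> \<bar>z - z'\<bar>" for z z'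
        by (auto simp: cl_def max_def min_def)
      from this[of "real n * t - real i" "real n * s - real i"]
      have "\<bar>cl (real n * t - real i) - cl (real n * s - real i)\<bar> \<le> real n * \<bar>t - s\<bar>"
        by (simp add: abs_mult flip: right_diff_distrib)
      then show "norm ((cl (real n * t - real i) - cl (real n * s - real i)) *\<^sub>R w i) \<le> real n * \<bar>t - s\<bar> * norm (w i)"
        by (simp add: mult_right_mono)
    qed
    also have "\<dots> = M * \<bar>t - s\<bar>"
      by (simp add: M_def sum_distrib_left sum_distrib_right mult_ac)
    finally show ?thesis .
  qed
  have M: "0 \<le> M"
    unfolding M_def by (rule sum_nonneg) simp
  have \<gamma>0: "\<gamma> 0 = p"
    by (simp add: \<gamma>_def cl_def)
  have "cl (real n - real i) = 1" if "i < n" for i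
    using that by (simp add: cl_def)
  then have \<gamma>1: "\<gamma> 1 = gmul B p (hprod B (map a [0..<n]))"
    by (simp add: \<gamma>_def hprod_upt_translate w_def x_def)
  have piece: "\<gamma> s = p + (\<Sum>i<j. w i) + (real n * s - real j) *\<^sub>R w j"
    if j: "j < n" and s: "real j < real n * s" "real n * s < real j + 1" for j s
  proof -
    have "cl (real n * s - real i) *\<^sub>R w i =
        (if i < j then w i else 0) + (if i = j then (real n * s - real j) *\<^sub>R w i else 0)" for i
    proof -
      consider "i + 1 \<le> j" | "i = j" | "j + 1 \<le> i" by linarith
      then show ?thesis
      proof cases
        case 1
        then have "real i + 1 \<le> real j" by linarith
        then show ?thesis using 1 s by (simp add: cl_def)
      next
        case 2
        then show ?thesis using s by (simp add: cl_def)
      next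
        case 3
        then have "real j + 1 \<le> real i" by linarith
        then show ?thesis using 3 s by (simp add: cl_def)
      qed
    qed
    then have "(\<Sum>i<n. cl (real n * s - real i) *\<^sub>R w i) =
        (\<Sum>i<n. if i < j then w i else 0) + (\<Sum>i<n. if i = j then (real n * s - real j) *\<^sub>R w i else 0)"
      by (simp add: sum.distrib)
    also have "(\<Sum>i<n. if i < j then w i else 0) = (\<Sum>i<j. w i)"
    proof -
      have "{..<n} \<inter> {i. i < j} = {..<j}" using j by auto
      then show ?thesis by (simp flip: sum.inter_restrict add: sum.If_cases)
    qed
    finally show ?thesis
      using j by (simp add: \<gamma>_def)
  qed
  \<comment> \<open>The curve may have corners at these finitely many breakpoints.\<close>
  define bad where "bad = (\<lambda>i. real i / real n) ` {..n}"
  have "negligible bad"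
    by (rule negligible_finite) (simp add: bad_def)
  then have "AE t in lebesgue. t \<notin> bad"
    by (simp add: negligible_iff_null_sets AE_not_in)
  moreover have "(\<gamma> has_vector_derivative (u t, B (fst (\<gamma> t)) (u t))) (at t)" if t: "t \<in> {0..1}" "t \<notin> bad" for t
  proof -
    define j where "j = nat \<lfloor>real n * t\<rfloor>"
    have nt: "0 \<le> real n * t" using t by simp
    have j1: "real j \<le> real n * t" "real n * t < real j + 1"
      using nt unfolding j_def by linarith+
    have "real n * t \<le> real n" using t n by simp
    then have "j \<le> n" using j1 by linarith
    have "real j \<noteq> real n * t"
    proof
      assume "real j = real n * t"
      then have "t = real j / real n"
        using n by simp
      then show False
        using t(2) \<open>j \<le> n\<close> unfolding bad_def by auto
    qed
    then have j2: "real j < real n * t" using j1 by linarith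
    then have jn: "j < n" using \<open>real n * t \<le> real n\<close> by linarith
    have "((\<lambda>s. p + (\<Sum>i<j. w i) + (real n * s - real j) *\<^sub>R w j) has_vector_derivative real n *\<^sub>R w j) (at t)"
      by (auto intro!: derivative_eq_intros)
    then have der: "(\<gamma> has_vector_derivative real n *\<^sub>R w j) (at t)"
    proof (rule has_vector_derivative_transform_within_open)
      show "open {real j / real n<..<(real j + 1) / real n}" by simp
      show "t \<in> {real j / real n<..<(real j + 1) / real n}"
        using j1 j2 n by (simp add: field_simps)
      show "p + (\<Sum>i<j. w i) + (real n * s - real j) *\<^sub>R w j = \<gamma> s"
        if "s \<in> {real j / real n<..<(real j + 1) / real n}" for s
        using that n by (intro piece[OF jn, symmetric]) (simp_all add: field_simps)
    qed
    have "fst (\<gamma> t) = x j + (real n * t - real j) *\<^sub>R a j"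
      unfolding piece[OF jn j2 j1(2)] by (simp add: fst_sum w_def x_def)
    \<comment> \<open>Beyond \<open>x j\<close> the position is displaced by a multiple of
      \<open>a j\<close>, which \<open>B\<close> annihilates against \<open>a j\<close>. So the
      fixed direction \<open>w j\<close> stays horizontal along the whole segment.\<close>
    then have "real n *\<^sub>R w j = (u t, B (fst (\<gamma> t)) (u t))"
      by (simp add: w_def u_def j_def[symmetric] B.add_left B.scaleR_left B.scaleR_right)
    then show ?thesis
      using der by simp
  qed
  ultimately have der: "AE t in lebesgue. t \<in> {0..1} \<longrightarrow> (\<gamma> has_vector_derivative (u t, B (fst (\<gamma> t)) (u t))) (at t)"
    by (auto elim: AE_mp)
  have hi: "((\<lambda>t. norm (u t)) has_integral (\<Sum>i<k. norm (a i))) {0..real k / real n}" for k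
  proof (induction k)
    case 0
    show ?case using has_integral_null_real[of 0 0] by simp
  next
    case (Suc k)
    \<comment> \<open>The right end is excepted, because the floor jumps there to the next
      step.\<close>
    have "((\<lambda>t. norm (u t)) has_integral norm (a k)) {real k / real n..real (Suc k) / real n}"
    proof (rule has_integral_spike_finite[where S = "{real (Suc k) / real n}"])
      have "((\<lambda>t. real n * norm (a k)) has_integral (real (Suc k) / real n - real k / real n) *\<^sub>R (real n * norm (a k)))
          {real k / real n..real (Suc k) / real n}"
        using has_integral_const_real[of "real n * norm (a k)" "real k / real n" "real (Suc k) / real n"] n
        by (simp add: divide_right_mono)
      then show "((\<lambda>t. real n * norm (a k)) has_integral norm (a k)) {real k / real n..real (Suc k) / real n}"
        using n by (simp flip: diff_divide_distrib)
      fix t assume "t \<in> {real k / real n..real (Suc k) / real n} - {real (Suc k) / real n}"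
      then have "real k \<le> real n * t" "real n * t < real k + 1"
        using n by (auto simp: field_simps)
      then have "nat \<lfloor>real n * t\<rfloor> = k"
        by linarith
      then show "norm (u t) = real n * norm (a k)"
        by (simp add: u_def)
    qed simp
    from has_integral_combine[OF _ _ Suc.IH this] show ?case
      using n by (simp add: divide_right_mono)
  qed
  have "((\<lambda>t. norm (u t)) has_integral (\<Sum>i<n. norm (a i))) {0..1}"
    using hi[of n] n by simp
  then have "(\<lambda>t. norm (u t)) integrable_on {0..1}" "integral {0..1} (\<lambda>t. norm (u t)) = (\<Sum>i<n. norm (a i))"
    by (auto simp: has_integral_iff)
  moreover from this have "horiz_curve B \<gamma> u p (gmul B p (hprod B (map a [0..<n])))"
    unfolding horiz_curve_def horizontal_velocity
    using abs_cont_on_lipschitz[OF M lip] \<gamma>0 \<gamma>1 der by auto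
  ultimately show ?thesis
    using that by blast
qed

lemma horiz_curve_of_list:
  obtains \<gamma> u where "horiz_curve B \<gamma> u p (gmul B p (hprod B xs))" "integral {0..1} (\<lambda>t. norm (u t)) = hlen xs"
proof -
  \<comment> \<open>A trivial step replaces the empty list, since time is divided by the number of
    steps.\<close>
  define ys where "ys = (if xs = [] then [0] else xs)"
  have ys: "hprod B ys = hprod B xs" "hlen ys = hlen xs" "0 < length ys"
    by (auto simp: ys_def zero_prod_def gmul_def)
  have m: "map ((!) ys) [0..<length ys] = ys"
    by (rule map_nth)
  obtain \<gamma> u where "horiz_curve B \<gamma> u p (gmul B p (hprod B (map ((!) ys) [0..<length ys])))"
    "integral {0..1} (\<lambda>t. norm (u t)) = (\<Sum>i<length ys. norm (ys ! i))"
    by (rule horiz_curve_of_steps[OF ys(3)])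
  then show ?thesis
    using that ys hlen_upt[of "(!) ys" "length ys"] by (simp add: m)
qed

text \<open>Every polygon is traced by an admissible curve of the same length, and every admissible
  curve is matched by a polygon with arbitrarily small excess length. Left translation by
  \<open>- p\<close> moves the start to the origin.\<close>

lemma cc_dist_eq_hdist: "cc_dist B p q = hdist B (gmul B (- p) q)"
proof (rule antisym)
  let ?S = "{integral {0..1} (\<lambda>t. norm (u t)) | \<gamma> u. horiz_curve B \<gamma> u p q}"
  have cancel: "gmul B p (gmul B (- p) q) = q"
    by (simp flip: gmul_assoc)
  have bdd: "bdd_below ?S"
    by (rule bdd_belowI[of _ 0]) (auto simp: horiz_curve_def intro!: integral_nonneg)
  have ex: "\<exists>l\<in>?S. l = hlen xs" if "hprod B xs = gmul B (- p) q" for xs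
  proof -
    obtain \<gamma> u where \<gamma>: "horiz_curve B \<gamma> u p (gmul B p (hprod B xs))"
      and u: "integral {0..1} (\<lambda>t. norm (u t)) = hlen xs"
      by (rule horiz_curve_of_list)
    have "horiz_curve B \<gamma> u p q"
      using \<gamma> unfolding that cancel .
    then show ?thesis
      using u by blast
  qed
  show "cc_dist B p q \<le> hdist B (gmul B (- p) q)"
  proof (rule field_le_epsilon)
    fix e :: real assume "e > 0"
    then obtain xs where xs: "hprod B xs = gmul B (- p) q" "hlen xs < hdist B (gmul B (- p) q) + e"
      using hdist_approx[of "gmul B (- p) q" "hdist B (gmul B (- p) q) + e"] by auto
    have "cc_dist B p q \<le> hlen xs"
      unfolding cc_dist_def using ex[OF xs(1)] bdd by (auto intro: cInf_lower)
    then show "cc_dist B p q \<le> hdist B (gmul B (- p) q) + e"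
      using xs(2) by simp
  qed
  show "hdist B (gmul B (- p) q) \<le> cc_dist B p q"
    unfolding cc_dist_def
  proof (rule cInf_greatest)
    obtain xs where "hprod B xs = gmul B (- p) q"
      using ex_hprod by blast
    then show "?S \<noteq> {}"
      using ex by blast
    fix l assume "l \<in> ?S"
    then obtain \<gamma> u where l: "l = integral {0..1} (\<lambda>t. norm (u t))" "horiz_curve B \<gamma> u p q"
      by blast
    show "hdist B (gmul B (- p) q) \<le> l"
    proof (rule field_le_epsilon)
      fix e :: real assume "e > 0"
      obtain xs where xs: "gmul B p (hprod B xs) = q" "hlen xs \<le> l + e"
        using list_of_horiz_curve[OF l(2) \<open>e > 0\<close>] l(1) by blast
      have "hprod B xs = gmul B (- p) q"
        by (simp add: xs(1)[symmetric] flip: gmul_assoc)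
      then show "hdist B (gmul B (- p) q) \<le> l + e"
        using hdist_le[of xs] xs(2) by fastforce
    qed
  qed
qed

lemma cc_dist_origin: "cc_dist B p 0 = hdist B p"
  by (simp add: cc_dist_eq_hdist hdist_minus)

end

subsection \<open>Perturbation of polygonal paths\<close>

text \<open>Nonnegativity of the variance for the probability weights \<tau>.\<close>

lemma square_weighted_sum_le:
  fixes \<tau> w :: "nat \<Rightarrow> real"
  assumes "\<And>i. i < n \<Longrightarrow> 0 \<le> \<tau> i" "(\<Sum>i<n. \<tau> i) = 1"
  shows "(\<Sum>i<n. \<tau> i * w i)\<^sup>2 \<le> (\<Sum>i<n. \<tau> i * (w i)\<^sup>2)"
proof -
  define m where "m = (\<Sum>i<n. \<tau> i * w i)"
  have "0 \<le> (\<Sum>i<n. \<tau> i * (w i - m)\<^sup>2)"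
    by (rule sum_nonneg) (use assms(1) in auto)
  also have "\<dots> = (\<Sum>i<n. \<tau> i * (w i)\<^sup>2 - 2 * m * (\<tau> i * w i) + m\<^sup>2 * \<tau> i)"
    by (rule sum.cong) (auto simp: power2_eq_square algebra_simps)
  also have "\<dots> = (\<Sum>i<n. \<tau> i * (w i)\<^sup>2) - 2 * m * m + m\<^sup>2 * 1"
    by (simp only: sum.distrib sum_subtractf sum_distrib_left[symmetric] m_def[symmetric] assms(2))
  finally show ?thesis
    by (simp add: m_def power2_eq_square)
qed

section \<open>The adjoint of the bracket and the vertical area\<close>

context ideal_group
begin

text \<open>Up to normalisation, the Kaplan operator attached to the vertical vector \<mu>.\<close>

definition adj :: "real ^ 'k \<Rightarrow> real ^ 'm \<Rightarrow> real ^ 'm" where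
  "adj \<mu> x = adjoint (B x) \<mu>"

lemma inner_adj: "adj \<mu> x \<bullet> y = \<mu> \<bullet> B x y"
  unfolding adj_def by (rule adjoint_clauses(2)[OF bounded_linear.linear[OF B.bounded_linear_right]])

lemma norm_adj_le: "norm (adj \<mu> x) \<le> bnd * norm \<mu> * norm x"
proof (cases "adj \<mu> x = 0")
  case False
  let ?v = "adj \<mu> x"
  have "norm ?v * norm ?v = \<mu> \<bullet> B x ?v"
    by (simp add: inner_adj[symmetric] power2_norm_eq_inner[symmetric] power2_eq_square)
  also have "\<dots> \<le> norm \<mu> * norm (B x ?v)"
    by (rule norm_cauchy_schwarz)
  also have "\<dots> \<le> norm \<mu> * (bnd * norm x * norm ?v)"
    by (intro mult_left_mono norm_B_le norm_ge_zero)
  finally have "norm ?v * norm ?v \<le> (bnd * norm \<mu> * norm x) * norm ?v"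
    by (simp add: mult_ac)
  then show ?thesis
    using False by (metis mult_le_cancel_right norm_ge_zero norm_eq_zero order.not_eq_order_implies_strict not_le)
qed (use bnd_pos in simp)

sublocale adj: bounded_bilinear adj
proof
  show "adj (a + a') b = adj a b + adj a' b" for a a' b
    by (subst vector_eq_rdot[symmetric]) (simp add: inner_adj inner_add_left)
  show "adj a (b + b') = adj a b + adj a b'" for a b b'
    by (subst vector_eq_rdot[symmetric]) (simp add: inner_adj inner_add_left inner_add_right B.add_left)
  show "adj (r *\<^sub>R a) b = r *\<^sub>R adj a b" for r a b
    by (subst vector_eq_rdot[symmetric]) (simp add: inner_adj)
  show "adj a (r *\<^sub>R b) = r *\<^sub>R adj a b" for r a b
    by (subst vector_eq_rdot[symmetric]) (simp add: inner_adj B.scaleR_left)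
  show "\<exists>K. \<forall>a b. norm (adj a b) \<le> norm a * norm b * K"
    using norm_adj_le by (intro exI[of _ bnd]) (simp add: mult_ac)
qed

text \<open>By homogeneity it suffices to keep \<open>adj\<close> away from 0 on a product of unit
  spheres, which is compact. Fatness excludes a zero there: with \<open>B x w = \<mu>\<close> it
  would give \<open>\<mu> \<bullet> \<mu> = 0\<close>.\<close>

lemma norm_adj_ge: "\<exists>c>0. \<forall>\<mu> x. c * norm \<mu> * norm x \<le> norm (adj \<mu> x)"
proof -
  let ?S = "sphere (0::real^'k) 1 \<times> sphere (0::real^'m) 1"
  let ?f = "\<lambda>z. adj (fst z) (snd z)"
  have "compact ?S"
    by (intro compact_Times compact_sphere)
  moreover have "continuous_on ?S ?f"
    by (intro adj.continuous_on continuous_on_fst continuous_on_snd continuous_on_id)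
  moreover have "\<not> (\<exists>z\<in>?S. ?f z = 0)"
  proof
    assume "\<exists>z\<in>?S. ?f z = 0"
    then obtain \<mu> x where z: "norm \<mu> = 1" "norm x = 1" "adj \<mu> x = 0"
      by auto
    then have "x \<noteq> 0" by auto
    then obtain w where "B x w = \<mu>"
      by (rule B_surj)
    then have "\<mu> \<bullet> \<mu> = 0"
      using inner_adj[of \<mu> x w] z by simp
    then show False
      using z by simp
  qed
  ultimately obtain c where c: "0 < c" "\<forall>z\<in>?S. c \<le> norm (?f z)"
    by (rule brouwer_compactness_lemma)
  have "c * norm \<mu> * norm x \<le> norm (adj \<mu> x)" for \<mu> x
  proof (cases "\<mu> = 0 \<or> x = 0")
    case True
    then show ?thesis by auto
  next
    case False
    have "(\<mu> /\<^sub>R norm \<mu>, x /\<^sub>R norm x) \<in> ?S"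
      using False by simp
    then have "c \<le> norm (adj (\<mu> /\<^sub>R norm \<mu>) (x /\<^sub>R norm x))"
      using c(2) by fastforce
    also have "\<dots> = norm (adj \<mu> x) / (norm \<mu> * norm x)"
      by (simp add: adj.scaleR_left adj.scaleR_right divide_simps)
    finally show ?thesis
      using False by (simp add: field_simps)
  qed
  then show ?thesis
    using c(1) by blast
qed

text \<open>Vertical endpoint coordinate of the polygon with steps \<open>v i\<close>, as in
  \<open>hprod_upt\<close>.\<close>

definition area :: "nat \<Rightarrow> (nat \<Rightarrow> real ^ 'm) \<Rightarrow> real ^ 'k" where
  "area n v = (\<Sum>i<n. B (\<Sum>j<i. v j) (v i))"

text \<open>Summation by parts and skew symmetry move \<open>v\<close> from the first slot of the
  mixed terms to the second. The diagonal terms are shared equally, so segment midpoints appear; the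
  boundary term is \<open>B\<close> of the two total displacements.\<close>

lemma area_add:
  "area n (\<lambda>i. a i + v i) = area n a + area n v
    + 2 *\<^sub>R (\<Sum>i<n. B ((\<Sum>j<i. a j) + (1 / 2) *\<^sub>R a i) (v i)) - B (\<Sum>i<n. a i) (\<Sum>i<n. v i)"
proof (induction n)
  case 0
  then show ?case by (simp add: area_def)
next
  case (Suc n)
  define X Y where "X = (\<Sum>i<n. a i)" and "Y = (\<Sum>i<n. v i)"
  have "area (Suc n) (\<lambda>i. a i + v i) = area n (\<lambda>i. a i + v i) + B (X + Y) (a n + v n)"
    by (simp add: area_def X_def Y_def sum.distrib)
  moreover have "area (Suc n) a = area n a + B X (a n)" "area (Suc n) v = area n v + B Y (v n)"
    by (simp_all add: area_def X_def Y_def)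
  moreover have "B (a n) Y = - B Y (a n)"
    by (rule skew)
  ultimately show ?case
    unfolding Suc.IH sum.lessThan_Suc X_def[symmetric] Y_def[symmetric]
    by (simp add: B.add_left B.add_right B.scaleR_left scaleR_add_right algebra_simps scaleR_2)
qed

lemma norm_area_le: "norm (area n v) \<le> bnd * (\<Sum>i<n. norm (v i))\<^sup>2"
proof -
  define S where "S = (\<Sum>i<n. norm (v i))"
  have "norm (area n v) \<le> (\<Sum>i<n. bnd * S * norm (v i))"
    unfolding area_def
  proof (rule sum_norm_le)
    fix i assume "i \<in> {..<n}"
    have "norm (\<Sum>j<i. v j) \<le> (\<Sum>j<i. norm (v j))"
      by (rule norm_sum)
    also have "\<dots> \<le> S"
      unfolding S_def by (rule sum_mono2) (use \<open>i \<in> {..<n}\<close> in auto)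
    finally have "bnd * norm (\<Sum>j<i. v j) * norm (v i) \<le> bnd * S * norm (v i)"
      using bnd_pos by (intro mult_right_mono mult_left_mono) auto
    then show "norm (B (\<Sum>j<i. v j) (v i)) \<le> bnd * S * norm (v i)"
      using norm_B_le order_trans by blast
  qed
  also have "\<dots> = bnd * S\<^sup>2"
    by (simp add: sum_distrib_left[symmetric] S_def[symmetric] power2_eq_square)
  finally show ?thesis
    by (simp add: S_def)
qed

lemma continuous_on_area:
  assumes "\<And>i. i < n \<Longrightarrow> continuous_on S (\<lambda>\<mu>. v \<mu> i)"
  shows "continuous_on S (\<lambda>\<mu>. area n (v \<mu>))"
  unfolding area_def using assms by (intro continuous_on_sum B.continuous_on) auto

end

text \<open>Take the shortest initial block of weight above \<open>\<delta> / 2\<close>. Its last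
  weight is at most \<open>\<delta> / 2\<close>, so the block weighs at most \<delta>, and the
  minimum of \<open>f\<close> on it is controlled by the weighted sum. This locates a segment near
  the start of a path whose midpoint is close to the mean.\<close>

lemma small_index:
  fixes \<tau> f :: "nat \<Rightarrow> real"
  assumes \<tau>: "\<And>i. i < n \<Longrightarrow> 0 \<le> \<tau> i" "(\<Sum>i<n. \<tau> i) = 1" "\<And>i. i < n \<Longrightarrow> \<tau> i \<le> \<delta> / 2"
    and \<delta>: "0 < \<delta>" "\<delta> \<le> 1" and f: "\<And>i. 0 \<le> f i"
  shows "\<exists>i<n. (\<Sum>j\<le>i. \<tau> j) \<le> \<delta> \<and> \<delta> / 2 * f i \<le> (\<Sum>i<n. \<tau> i * f i)"
proof -
  define k where "k = (LEAST k. \<delta> / 2 < (\<Sum>j<k. \<tau> j))"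
  have n: "\<delta> / 2 < (\<Sum>j<n. \<tau> j)"
    using \<tau>(2) \<delta> by simp
  have k: "\<delta> / 2 < (\<Sum>j<k. \<tau> j)" "k \<le> n"
    unfolding k_def by (rule LeastI[of _ n], fact n) (rule Least_le, fact n)
  have "k \<noteq> 0"
    using k(1) \<delta>(1) by (intro notI) simp
  then obtain m where m: "k = Suc m"
    using not0_implies_Suc by blast
  have "(\<Sum>j<m. \<tau> j) \<le> \<delta> / 2"
    using not_less_Least[of m "\<lambda>k. \<delta> / 2 < (\<Sum>j<k. \<tau> j)"] m unfolding k_def[symmetric] by simp
  then have k\<delta>: "(\<Sum>j<k. \<tau> j) \<le> \<delta>"
    using \<tau>(3)[of m] m k(2) by simp
  have "Min (f ` {..<k}) \<in> f ` {..<k}"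
    by (rule Min_in) (use m in auto)
  then obtain i where i: "i < k" "f i = Min (f ` {..<k})"
    by auto
  have "\<delta> / 2 * f i \<le> (\<Sum>j<k. \<tau> j) * f i"
    using k(1) f by (intro mult_right_mono) auto
  also have "\<dots> = (\<Sum>j<k. \<tau> j * f i)"
    by (rule sum_distrib_right)
  also have "\<dots> \<le> (\<Sum>j<k. \<tau> j * f j)"
  proof (rule sum_mono)
    fix j assume "j \<in> {..<k}"
    then show "\<tau> j * f i \<le> \<tau> j * f j"
      using \<tau>(1)[of j] k(2) i(2) by (intro mult_left_mono) auto
  qed
  also have "\<dots> \<le> (\<Sum>j<n. \<tau> j * f j)"
    by (rule sum_mono2) (use \<tau>(1) f k(2) in auto)
  finally have "\<delta> / 2 * f i \<le> (\<Sum>j<n. \<tau> j * f j)" .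
  moreover have "(\<Sum>j\<le>i. \<tau> j) \<le> (\<Sum>j<k. \<tau> j)"
    by (rule sum_mono2) (use i(1) k(2) \<tau>(1) in auto)
  ultimately show ?thesis
    using k\<delta> i(1) k(2) by (intro exI[of _ i]) auto
qed

text \<open>Time reversal of \<open>small_index\<close>, locating a segment near the end.\<close>

lemma small_index_rev:
  fixes \<tau> f :: "nat \<Rightarrow> real"
  assumes \<tau>: "\<And>i. i < n \<Longrightarrow> 0 \<le> \<tau> i" "(\<Sum>i<n. \<tau> i) = 1" "\<And>i. i < n \<Longrightarrow> \<tau> i \<le> \<delta> / 2"
    and \<delta>: "0 < \<delta>" "\<delta> \<le> 1" and f: "\<And>i. 0 \<le> f i"
  shows "\<exists>i<n. (\<Sum>j\<in>{i..<n}. \<tau> j) \<le> \<delta> \<and> \<delta> / 2 * f i \<le> (\<Sum>i<n. \<tau> i * f i)"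
proof -
  have "\<exists>i<n. (\<Sum>j\<le>i. \<tau> (n - Suc j)) \<le> \<delta> \<and> \<delta> / 2 * f (n - Suc i) \<le> (\<Sum>i<n. \<tau> (n - Suc i) * f (n - Suc i))"
    by (rule small_index) (use \<tau> \<delta> f in \<open>auto simp: sum.nat_diff_reindex[of \<tau>]\<close>)
  then obtain i where i: "i < n" "(\<Sum>j\<le>i. \<tau> (n - Suc j)) \<le> \<delta>"
      "\<delta> / 2 * f (n - Suc i) \<le> (\<Sum>i<n. \<tau> (n - Suc i) * f (n - Suc i))"
    by blast
  have "(\<Sum>j\<le>i. \<tau> (n - Suc j)) = (\<Sum>j\<in>{n - Suc i..<n}. \<tau> j)"
    by (rule sum.reindex_bij_witness[of _ "\<lambda>l. n - Suc l" "\<lambda>l. n - Suc l"]) (use i(1) in auto)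
  moreover have "(\<Sum>i<n. \<tau> (n - Suc i) * f (n - Suc i)) = (\<Sum>i<n. \<tau> i * f i)"
    by (rule sum.nat_diff_reindex[of "\<lambda>i. \<tau> i * f i"])
  ultimately show ?thesis
    using i by (intro exI[of _ "n - Suc i"]) auto
qed

text \<open>A polygonal horizontal path with steps \<open>a i\<close>, run in time \<open>\<tau> i\<close> at speed at most \<open>L\<close>; \<open>mid i\<close> is
  the midpoint of the \<open>i\<close>-th horizontal segment.\<close>

locale timed_path = ideal_group B for B :: "real ^ 'm \<Rightarrow> real ^ 'm \<Rightarrow> real ^ 'k" +
  fixes n :: nat and \<tau> :: "nat \<Rightarrow> real" and g :: "nat \<Rightarrow> real ^ 'm" and L :: real
    and a mid dev :: "nat \<Rightarrow> real ^ 'm" and total mean :: "real ^ 'm"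
  defines "a \<equiv> \<lambda>i. \<tau> i *\<^sub>R g i"
    and "mid \<equiv> \<lambda>i. (\<Sum>j<i. a j) + (1 / 2) *\<^sub>R a i"
    and "total \<equiv> \<Sum>i<n. a i"
    and "mean \<equiv> \<Sum>i<n. \<tau> i *\<^sub>R mid i"
    and "dev \<equiv> \<lambda>i. mid i - mean"
  assumes \<tau>: "\<And>i. i < n \<Longrightarrow> 0 \<le> \<tau> i" "(\<Sum>i<n. \<tau> i) = 1"
    and g: "\<And>i. i < n \<Longrightarrow> norm (g i) \<le> L"
    and L: "0 < L"
begin

section \<open>Size bounds for timed paths\<close>

lemma mean_le:
  assumes "\<And>i. i < n \<Longrightarrow> f i \<le> C"
  shows "(\<Sum>i<n. \<tau> i * f i) \<le> C"
proof -
  have "(\<Sum>i<n. \<tau> i * f i) \<le> (\<Sum>i<n. \<tau> i * C)"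
    by (rule sum_mono) (use assms \<tau>(1) in \<open>auto intro!: mult_left_mono\<close>)
  then show ?thesis
    by (simp add: sum_distrib_right[symmetric] \<tau>(2))
qed

lemma norm_a: "i < n \<Longrightarrow> norm (a i) \<le> \<tau> i * L"
  using \<tau>(1)[of i] g[of i] by (auto simp: a_def intro: mult_left_mono)

lemma sum_norm_a: "(\<Sum>i<n. norm (a i)) \<le> L"
proof -
  have "(\<Sum>i<n. norm (a i)) \<le> (\<Sum>i<n. \<tau> i * L)"
    by (rule sum_mono) (use norm_a in auto)
  then show ?thesis
    by (simp add: sum_distrib_right[symmetric] \<tau>(2))
qed

lemma norm_partial: "i \<le> n \<Longrightarrow> norm (\<Sum>j<i. a j) \<le> L"
proof -
  assume "i \<le> n"
  have "norm (\<Sum>j<i. a j) \<le> (\<Sum>j<i. norm (a j))"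
    by (rule norm_sum)
  also have "\<dots> \<le> (\<Sum>j<n. norm (a j))"
    by (rule sum_mono2) (use \<open>i \<le> n\<close> in auto)
  finally show ?thesis
    using sum_norm_a by linarith
qed

lemma norm_total: "norm total \<le> L"
  using norm_partial[of n] by (simp add: total_def)

lemma norm_mid: "i < n \<Longrightarrow> norm (mid i) \<le> 2 * L"
proof -
  assume i: "i < n"
  have "norm (a i) \<le> (\<Sum>j<n. norm (a j))"
    by (rule member_le_sum) (use i in auto)
  then have "norm ((1 / 2) *\<^sub>R a i) \<le> L"
    using sum_norm_a L by simp
  then show ?thesis
    unfolding mid_def using norm_partial[of i] i norm_triangle_ineq[of "\<Sum>j<i. a j" "(1 / 2) *\<^sub>R a i"] by linarith
qed

lemma norm_mean: "norm mean \<le> 2 * L"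
proof -
  have "norm mean \<le> (\<Sum>i<n. \<tau> i * norm (mid i))"
    unfolding mean_def by (rule sum_norm_le) (use \<tau>(1) in auto)
  also have "\<dots> \<le> 2 * L"
    by (rule mean_le) (rule norm_mid)
  finally show ?thesis .
qed

lemma norm_dev: "i < n \<Longrightarrow> norm (dev i) \<le> 4 * L"
  using norm_mid[of i] norm_mean norm_triangle_ineq4[of "mid i" mean] unfolding dev_def by linarith

lemma sum_dev: "(\<Sum>i<n. \<tau> i *\<^sub>R dev i) = 0"
  by (simp add: dev_def scaleR_diff_right sum_subtractf mean_def[symmetric] scaleR_sum_left[symmetric] \<tau>(2))

text \<open>By fatness only a path whose midpoints hardly move is close to being abnormal. Such a path has
  an endpoint much closer to the origin than its length, by the ball-box estimate \<open>C0\<close>.\<close>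

lemma spread:
  assumes C0: "0 < C0" "\<And>p. hdist B p \<le> C0 * (norm (fst p) + sqrt (norm (snd p)))"
    and E: "E = 8 * C0\<^sup>2 * (1 + 2 * bnd) + 1" and F: "F = 8 * C0\<^sup>2 * bnd"
    and fine: "\<And>i. i < n \<Longrightarrow> \<tau> i \<le> 1 / (8 * E)"
    and short: "L \<le> 2 * hdist B (total, area n a)"
  shows "L \<le> 2 * (16 * E\<^sup>2 + F) * (\<Sum>i<n. \<tau> i * norm (dev i))"
proof -
  define s where "s = (\<Sum>i<n. \<tau> i * norm (dev i))"
  \<comment> \<open>\<open>\<delta> / 2\<close> is exactly the largest time fraction allowed for a
    segment, and \<open>E * (2 * \<delta> * L) = L / 2\<close> can be absorbed at the end.\<close>
  define \<delta> where "\<delta> = 1 / (4 * E)"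
  have E1: "1 \<le> E"
    using bnd_pos by (simp add: E)
  have \<delta>: "0 < \<delta>" "\<delta> \<le> 1" "\<delta> / 2 = 1 / (8 * E)"
    using E1 by (simp_all add: \<delta>_def)
  have fine': "\<tau> i \<le> \<delta> / 2" if "i < n" for i
    using fine[OF that] \<delta>(3) by linarith
  have s0: "0 \<le> s"
    unfolding s_def by (rule sum_nonneg) (use \<tau>(1) in auto)
  \<comment> \<open>Segments \<open>i\<close> and \<open>j\<close> lie within time \<delta> of the
    two ends of the path, with deviations controlled by \<open>s\<close>.\<close>
  have "\<exists>i<n. (\<Sum>j\<le>i. \<tau> j) \<le> \<delta> \<and> \<delta> / 2 * norm (dev i) \<le> s"
    unfolding s_def by (rule small_index) (use \<tau> fine' \<delta> in auto)
  then obtain i where i: "i < n" "(\<Sum>j\<le>i. \<tau> j) \<le> \<delta>" "\<delta> / 2 * norm (dev i) \<le> s"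
    by blast
  have "\<exists>j<n. (\<Sum>l\<in>{j..<n}. \<tau> l) \<le> \<delta> \<and> \<delta> / 2 * norm (dev j) \<le> s"
    unfolding s_def by (rule small_index_rev) (use \<tau> fine' \<delta> in auto)
  then obtain j where j: "j < n" "(\<Sum>l\<in>{j..<n}. \<tau> l) \<le> \<delta>" "\<delta> / 2 * norm (dev j) \<le> s"
    by blast
  have half: "norm ((1 / 2) *\<^sub>R a l) \<le> norm (a l)" for l
    by simp
  have mi: "norm (mid i) \<le> \<delta> * L"
  proof -
    have "norm (mid i) \<le> (\<Sum>l<i. norm (a l)) + norm (a i)"
      unfolding mid_def using half[of i] norm_sum[of a "{..<i}"] norm_triangle_ineq[of "\<Sum>j<i. a j" "(1 / 2) *\<^sub>R a i"]
      by linarith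
    also have "\<dots> = (\<Sum>l\<le>i. norm (a l))"
      by (simp add: lessThan_Suc_atMost[symmetric])
    also have "\<dots> \<le> (\<Sum>l\<le>i. \<tau> l * L)"
      by (rule sum_mono) (use norm_a i(1) in auto)
    also have "\<dots> \<le> \<delta> * L"
      using i(2) L by (simp add: sum_distrib_right[symmetric])
    finally show ?thesis .
  qed
  have mj: "norm (total - mid j) \<le> \<delta> * L"
  proof -
    have "total = (\<Sum>l<j. a l) + (\<Sum>l\<in>{j..<n}. a l)"
      unfolding total_def lessThan_atLeast0 using j(1) by (intro sum.atLeastLessThan_concat[symmetric]) auto
    moreover have "(\<Sum>l\<in>{j..<n}. a l) = a j + (\<Sum>l\<in>{Suc j..<n}. a l)"
      using j(1) by (rule sum.atLeast_Suc_lessThan)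
    ultimately have "total - mid j = (\<Sum>l<j. a l) + (a j + (\<Sum>l\<in>{Suc j..<n}. a l)) - ((\<Sum>l<j. a l) + (1 / 2) *\<^sub>R a j)"
      unfolding mid_def by (simp only:)
    also have "\<dots> = (a j - (1 / 2) *\<^sub>R a j) + (\<Sum>l\<in>{Suc j..<n}. a l)"
      by simp
    also have "a j - (1 / 2) *\<^sub>R a j = (1 - 1 / 2) *\<^sub>R a j"
      by (simp only: scaleR_left_diff_distrib scaleR_one)
    finally have tm: "total - mid j = (1 / 2) *\<^sub>R a j + (\<Sum>l\<in>{Suc j..<n}. a l)"
      by simp
    have "norm (total - mid j) \<le> norm (a j) + (\<Sum>l\<in>{Suc j..<n}. norm (a l))"
      unfolding tm using half[of j] norm_sum[of a "{Suc j..<n}"] norm_triangle_ineq[of "(1 / 2) *\<^sub>R a j" "\<Sum>l\<in>{Suc j..<n}. a l"]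
      by linarith
    also have "\<dots> = (\<Sum>l\<in>{j..<n}. norm (a l))"
      using j(1) by (rule sum.atLeast_Suc_lessThan[symmetric])
    also have "\<dots> \<le> (\<Sum>l\<in>{j..<n}. \<tau> l * L)"
      by (rule sum_mono) (use norm_a in auto)
    also have "\<dots> \<le> \<delta> * L"
      using j(2) L by (simp add: sum_distrib_right[symmetric])
    finally show ?thesis .
  qed
  have di: "norm (dev l) \<le> 2 * s / \<delta>" if "\<delta> / 2 * norm (dev l) \<le> s" for l
  proof -
    have "norm (dev l) * \<delta> \<le> 2 * s"
      using that by (simp add: mult.commute)
    then show ?thesis
      using \<delta>(1) by (simp only: pos_le_divide_eq)
  qed
  \<comment> \<open>Go from the origin to \<open>mid i\<close>, then to \<open>mid j\<close>, then
    to the end: the outer legs take little time and the middle one is a difference of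
    deviations.\<close>
  have P1: "norm total \<le> 2 * \<delta> * L + 4 * s / \<delta>"
  proof -
    have "(total - mid j) + (mid i + (dev j - dev i)) = total"
      by (simp add: dev_def)
    then have "norm total \<le> norm (total - mid j) + norm (mid i + (dev j - dev i))"
      using norm_triangle_ineq[of "total - mid j" "mid i + (dev j - dev i)"] by (simp only:)
    then have "norm total \<le> norm (total - mid j) + (norm (mid i) + (norm (dev j) + norm (dev i)))"
      using norm_triangle_ineq[of "mid i" "dev j - dev i"] norm_triangle_ineq4[of "dev j" "dev i"] by linarith
    then show ?thesis
      using mi mj di[OF i(3)] di[OF j(3)] by simp
  qed
  have P2: "norm (area n a) \<le> L * (bnd * s + 2 * bnd * norm total)"
  proof -
    \<comment> \<open>Since \<open>B (a l) (a l) = 0\<close>, midpoints may replace starting points;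
      then the constant \<open>mean\<close> is split off.\<close>
    have "area n a = (\<Sum>l<n. B (mid l) (a l))"
      unfolding area_def mid_def by (simp add: B.add_left B.scaleR_left)
    also have "\<dots> = (\<Sum>l<n. B (dev l) (a l)) + B mean total"
      by (simp add: dev_def total_def B.diff_left B.sum_right sum_subtractf)
    finally have "norm (area n a) \<le> norm (\<Sum>l<n. B (dev l) (a l)) + norm (B mean total)"
      by (simp only: norm_triangle_ineq)
    moreover have "norm (\<Sum>l<n. B (dev l) (a l)) \<le> (\<Sum>l<n. bnd * L * (\<tau> l * norm (dev l)))"
    proof (rule sum_norm_le)
      fix l assume "l \<in> {..<n}"
      then have "bnd * norm (dev l) * norm (a l) \<le> bnd * norm (dev l) * (\<tau> l * L)"
        using norm_a bnd_pos by (intro mult_left_mono) auto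
      then show "norm (B (dev l) (a l)) \<le> bnd * L * (\<tau> l * norm (dev l))"
        using norm_B_le[of "dev l" "a l"] by (simp add: mult_ac)
    qed
    moreover have "(\<Sum>l<n. bnd * L * (\<tau> l * norm (dev l))) = bnd * L * s"
      by (simp add: s_def sum_distrib_left)
    moreover have "norm (B mean total) \<le> bnd * (2 * L) * norm total"
    proof -
      have "bnd * norm mean * norm total \<le> bnd * (2 * L) * norm total"
        using norm_mean bnd_pos by (intro mult_right_mono mult_left_mono) auto
      then show ?thesis
        using norm_B_le[of mean total] by linarith
    qed
    ultimately have "norm (area n a) \<le> bnd * L * s + bnd * (2 * L) * norm total"
      by linarith
    then show ?thesis
      by (simp add: algebra_simps)
  qed
  \<comment> \<open>Squaring makes the ball-box bound linear in the area. Every term then carries a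
    factor \<open>L\<close>, which cancels.\<close>
  have "L\<^sup>2 \<le> (2 * (C0 * (norm total + sqrt (norm (area n a)))))\<^sup>2"
    using short C0(2)[of "(total, area n a)"] L by (intro power_mono) auto
  also have "\<dots> = 4 * C0\<^sup>2 * (norm total + sqrt (norm (area n a)))\<^sup>2"
    by (simp add: power_mult_distrib)
  also have "\<dots> \<le> 4 * C0\<^sup>2 * (2 * ((norm total)\<^sup>2 + norm (area n a)))"
  proof (rule mult_left_mono)
    have "(x + y)\<^sup>2 \<le> 2 * (x\<^sup>2 + y\<^sup>2)" for x y :: real
      using zero_le_power2[of "x - y"] by (simp add: power2_eq_square algebra_simps)
    from this[of "norm total" "sqrt (norm (area n a))"]
    show "(norm total + sqrt (norm (area n a)))\<^sup>2 \<le> 2 * ((norm total)\<^sup>2 + norm (area n a))"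
      by simp
  qed simp
  also have "\<dots> \<le> 4 * C0\<^sup>2 * (2 * (L * norm total + L * (bnd * s + 2 * bnd * norm total)))"
  proof (intro mult_left_mono add_mono P2)
    show "(norm total)\<^sup>2 \<le> L * norm total"
      using norm_total by (simp add: power2_eq_square mult_right_mono)
  qed auto
  also have "\<dots> = L * (8 * C0\<^sup>2 * (1 + 2 * bnd) * norm total + F * s)"
    by (simp add: F algebra_simps)
  finally have "L \<le> 8 * C0\<^sup>2 * (1 + 2 * bnd) * norm total + F * s"
    using L by (simp add: power2_eq_square)
  also have "\<dots> \<le> E * norm total + F * s"
    unfolding E by (simp add: distrib_right)
  also have "\<dots> \<le> E * (2 * \<delta> * L + 4 * s / \<delta>) + F * s"
    using P1 E1 by (intro add_right_mono mult_left_mono) auto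
  also have "\<dots> = L / 2 + (16 * E\<^sup>2 + F) * s"
    using E1 by (simp add: \<delta>_def power2_eq_square algebra_simps)
  finally show ?thesis
    unfolding s_def[symmetric] mult.assoc by linarith
qed

end

text \<open>Quantitative nondegeneracy of a path. Both sides of \<open>coercive\<close> scale like
  \<open>L\<^sup>2\<close>, so one \<open>k\<close> can serve paths of every length.\<close>

locale coercive_path = timed_path B n \<tau> g L
  for B :: "real ^ 'm \<Rightarrow> real ^ 'm \<Rightarrow> real ^ 'k" and n \<tau> g L +
  fixes k :: real
  assumes k: "0 < k"
    and coercive: "\<And>\<mu>. k * L\<^sup>2 * (norm \<mu>)\<^sup>2 \<le> (\<Sum>i<n. \<tau> i * (norm (adj \<mu> (dev i)))\<^sup>2)"
begin

text \<open>The map sending velocities \<open>v\<close> to the weighted sum of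
  \<open>B (dev i) (v i)\<close>, composed with its adjoint
  \<open>\<mu> \<mapsto> adj \<mu> (dev i)\<close>. It is the linear part of the endpoint
  equation.\<close>

definition gram :: "real ^ 'k \<Rightarrow> real ^ 'k" where
  "gram \<mu> = (\<Sum>i<n. \<tau> i *\<^sub>R B (dev i) (adj \<mu> (dev i)))"

lemma linear_gram: "linear gram"
  by (rule linearI)
    (simp_all add: gram_def adj.add_left adj.scaleR_left B.add_right B.scaleR_right
      scaleR_add_right sum.distrib scaleR_sum_right mult.commute)

lemma inner_gram: "\<mu> \<bullet> gram \<mu> = (\<Sum>i<n. \<tau> i * (norm (adj \<mu> (dev i)))\<^sup>2)"
  by (simp add: gram_def inner_sum_right inner_adj[symmetric] power2_norm_eq_inner)

text \<open>Coercivity and Cauchy-Schwarz bound \<open>gram\<close> from below. It is therefore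
  injective, hence invertible in finite dimension, and the inverse obeys the reciprocal
  bound.\<close>

lemma ex_gram_inverse:
  "\<exists>G. linear G \<and> (\<forall>q. gram (G q) = q) \<and> (\<forall>q. norm (G q) \<le> norm q / (k * L\<^sup>2))"
proof -
  have bound: "k * L\<^sup>2 * norm \<mu> \<le> norm (gram \<mu>)" for \<mu>
  proof (cases "\<mu> = 0")
    case False
    have "k * L\<^sup>2 * (norm \<mu>)\<^sup>2 \<le> \<mu> \<bullet> gram \<mu>"
      using coercive inner_gram by simp
    also have "\<dots> \<le> norm \<mu> * norm (gram \<mu>)"
      by (rule norm_cauchy_schwarz)
    finally have "norm \<mu> * (k * L\<^sup>2 * norm \<mu>) \<le> norm \<mu> * norm (gram \<mu>)"
      by (simp add: power2_eq_square mult_ac)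
    then show ?thesis
      using False by simp
  qed simp
  have kL: "0 < k * L\<^sup>2"
    using k L by simp
  have "inj gram"
    unfolding linear_injective_0[OF linear_gram]
  proof (intro allI impI)
    fix \<mu> assume "gram \<mu> = 0"
    then have "k * L\<^sup>2 * norm \<mu> \<le> 0"
      using bound[of \<mu>] by simp
    then show "\<mu> = 0"
      using k L by (simp add: mult_le_0_iff)
  qed
  then obtain G where G: "linear G" "\<forall>q. gram (G q) = q"
    using linear_injective_isomorphism[OF linear_gram] by blast
  moreover have "norm (G q) \<le> norm q / (k * L\<^sup>2)" for q
    using bound[of "G q"] G(2) kL by (simp add: field_simps)
  ultimately show ?thesis
    by blast
qed

text \<open>The correction \<open>adj \<mu> (dev i)\<close> has weighted mean zero, so \<mu> steers
  the vertical endpoint only, while \<open>h\<close> shifts the horizontal one.\<close>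

definition vel :: "real ^ 'm \<Rightarrow> real ^ 'k \<Rightarrow> nat \<Rightarrow> real ^ 'm" where
  "vel h \<mu> i = h + adj \<mu> (dev i)"

lemma sum_adj_dev: "(\<Sum>i<n. \<tau> i *\<^sub>R adj \<mu> (dev i)) = 0"
proof -
  have "(\<Sum>i<n. \<tau> i *\<^sub>R adj \<mu> (dev i)) = adj \<mu> (\<Sum>i<n. \<tau> i *\<^sub>R dev i)"
    by (simp add: adj.sum_right adj.scaleR_right)
  then show ?thesis
    by (simp add: sum_dev adj.zero_right)
qed

lemma sum_vel: "(\<Sum>i<n. \<tau> i *\<^sub>R vel h \<mu> i) = h"
  by (simp add: vel_def scaleR_add_right sum.distrib sum_adj_dev scaleR_sum_left[symmetric] \<tau>(2))

text \<open>With \<open>mid i = mean + dev i\<close>, the mixed terms drop out because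
  \<open>dev\<close> and its image under \<open>adj \<mu>\<close> both have weighted mean
  zero.\<close>

lemma sum_B_mid: "(\<Sum>i<n. B (mid i) (\<tau> i *\<^sub>R vel h \<mu> i)) = B mean h + gram \<mu>"
proof -
  have "B (mid i) (\<tau> i *\<^sub>R vel h \<mu> i) =
      B mean (\<tau> i *\<^sub>R vel h \<mu> i) + B (\<tau> i *\<^sub>R dev i) h + \<tau> i *\<^sub>R B (dev i) (adj \<mu> (dev i))" for i
  proof -
    have "mid i = mean + dev i"
      by (simp add: dev_def)
    then show ?thesis
      by (simp add: vel_def B.add_left B.add_right B.scaleR_left B.scaleR_right scaleR_add_right)
  qed
  then have "(\<Sum>i<n. B (mid i) (\<tau> i *\<^sub>R vel h \<mu> i)) =
      B mean (\<Sum>i<n. \<tau> i *\<^sub>R vel h \<mu> i) + B (\<Sum>i<n. \<tau> i *\<^sub>R dev i) h + gram \<mu>"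
    by (simp add: sum.distrib B.sum_left B.sum_right gram_def)
  then show ?thesis
    by (simp add: sum_vel sum_dev)
qed

text \<open>The hypothesis is the endpoint equation that results from inserting
  \<open>sum_B_mid\<close> into \<open>area_add\<close>. The target is the vertical coordinate of
  the old endpoint multiplied by \<open>(h, 0)\<close>, whose twist is
  \<open>B total h\<close>.\<close>

lemma area_perturbed:
  assumes "gram \<mu> = B (total - mean) h - (1 / 2) *\<^sub>R area n (\<lambda>i. \<tau> i *\<^sub>R vel h \<mu> i)"
  shows "area n (\<lambda>i. a i + \<tau> i *\<^sub>R vel h \<mu> i) = area n a + B total h"
proof -
  have "area n (\<lambda>i. a i + \<tau> i *\<^sub>R vel h \<mu> i) = area n a + area n (\<lambda>i. \<tau> i *\<^sub>R vel h \<mu> i)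
      + 2 *\<^sub>R (B mean h + gram \<mu>) - B total h"
    unfolding area_add sum_vel total_def[symmetric] sum_B_mid[symmetric] mid_def ..
  also have "\<dots> = area n a + B total h"
    unfolding assms by (simp add: B.diff_left scaleR_add_right scaleR_diff_right scaleR_2)
  finally show ?thesis .
qed

text \<open>Squared length is at most energy, and the first-order part of the energy is linear in
  \<open>v\<close>, so it becomes odd in \<open>h\<close> once \<open>v\<close> is linear in
  \<open>h\<close>.\<close>

lemma energy_perturbed:
  assumes v: "\<And>i. i < n \<Longrightarrow> norm (v i) \<le> V"
  shows "(\<Sum>i<n. norm (a i + \<tau> i *\<^sub>R v i))\<^sup>2 \<le> L\<^sup>2 + 2 * (\<Sum>i<n. \<tau> i * (g i \<bullet> v i)) + V\<^sup>2"
proof -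
  have "norm (a i + \<tau> i *\<^sub>R v i) = \<tau> i * norm (g i + v i)" if "i < n" for i
    using \<tau>(1)[OF that] by (simp add: a_def flip: scaleR_add_right)
  then have "(\<Sum>i<n. norm (a i + \<tau> i *\<^sub>R v i))\<^sup>2 = (\<Sum>i<n. \<tau> i * norm (g i + v i))\<^sup>2"
    by simp
  also have "\<dots> \<le> (\<Sum>i<n. \<tau> i * (norm (g i + v i))\<^sup>2)"
    using \<tau> by (rule square_weighted_sum_le)
  also have "\<dots> = (\<Sum>i<n. \<tau> i * ((norm (g i))\<^sup>2 + (norm (v i))\<^sup>2) + 2 * (\<tau> i * (g i \<bullet> v i)))"
    by (rule sum.cong) (auto simp: power2_norm_eq_inner inner_add_left inner_add_right inner_commute algebra_simps)
  also have "\<dots> = (\<Sum>i<n. \<tau> i * ((norm (g i))\<^sup>2 + (norm (v i))\<^sup>2)) + 2 * (\<Sum>i<n. \<tau> i * (g i \<bullet> v i))"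
    by (simp add: sum.distrib sum_distrib_left)
  also have "(\<Sum>i<n. \<tau> i * ((norm (g i))\<^sup>2 + (norm (v i))\<^sup>2)) \<le> L\<^sup>2 + V\<^sup>2"
    by (rule mean_le) (use g v in \<open>auto intro!: add_mono power_mono\<close>)
  finally show ?thesis
    by simp
qed

lemma norm_vel:
  assumes "i < n" "norm \<mu> \<le> r"
  shows "norm (vel h \<mu> i) \<le> norm h + bnd * r * (4 * L)"
proof -
  have "norm (adj \<mu> (dev i)) \<le> bnd * norm \<mu> * norm (dev i)"
    by (rule norm_adj_le)
  also have "\<dots> \<le> bnd * r * (4 * L)"
    using bnd_pos order_trans[OF norm_ge_zero assms(2)]
    by (intro mult_mono[OF mult_left_mono[OF assms(2)] norm_dev[OF assms(1)]]) simp_all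
  finally show ?thesis
    unfolding vel_def using norm_triangle_ineq[of h "adj \<mu> (dev i)"] by linarith
qed

text \<open>The inverse of \<open>gram\<close> turns the endpoint equation into a fixed-point
  problem near its linear solution \<open>\<mu>1 h\<close>. The function \<open>l\<close> is the
  first variation of the energy along \<open>vel h (\<mu>1 h)\<close>; it is chosen before
  \<open>h\<close>, so that it serves both \<open>h\<close> and \<open>- h\<close>.\<close>

lemma ex_perturbation:
  assumes C1: "C1 = 3 * bnd / k" and C2: "C2 = 1 + 8 * bnd * C1" and C3: "C3 = bnd * C2\<^sup>2 / (2 * k)"
  shows "\<exists>l. (\<forall>h. l (- h) = - l h) \<and> (\<forall>h. C3 * norm h \<le> C1 * L \<longrightarrow>
    (\<exists>b. (\<Sum>i<n. b i) = total + h \<and> area n b = area n a + B total h \<and>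
      (\<Sum>i<n. norm (b i))\<^sup>2 \<le> L\<^sup>2 + l h + (8 * bnd * C3 + C2\<^sup>2) * (norm h)\<^sup>2))"
proof -
  have C1pos: "0 < C1"
    using bnd_pos k by (simp add: C1)
  have C2pos: "0 < C2"
    using bnd_pos C1pos by (simp add: C2 add_pos_pos)
  have C3pos: "0 < C3"
    using bnd_pos C2pos k by (simp add: C3)
  obtain G where "linear G \<and> (\<forall>q. gram (G q) = q) \<and> (\<forall>q. norm (G q) \<le> norm q / (k * L\<^sup>2))"
    using ex_gram_inverse by (elim exE)
  then have G: "linear G" "\<And>q. gram (G q) = q" "\<And>q. norm (G q) \<le> norm q / (k * L\<^sup>2)"
    by simp_all
  have kL: "0 < k * L\<^sup>2"
    using k L by simp
  define \<mu>1 where "\<mu>1 h = G (B (total - mean) h)" for h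
  define l where "l h = 2 * (\<Sum>i<n. \<tau> i * (g i \<bullet> vel h (\<mu>1 h) i))" for h
  have odd: "l (- h) = - l h" for h
  proof -
    have "vel (- h) (\<mu>1 (- h)) i = - vel h (\<mu>1 h) i" for i
      by (simp add: vel_def \<mu>1_def B.minus_right linear_neg[OF G(1)] adj.minus_left)
    then show ?thesis
      by (simp add: l_def sum_negf)
  qed
  have norm_base: "norm (total - mean) \<le> 3 * L"
    using norm_total norm_mean norm_triangle_ineq4[of total mean] by linarith
  have norm_\<mu>1: "norm (\<mu>1 h) \<le> C1 * norm h / L" for h
  proof -
    have "norm (B (total - mean) h) \<le> bnd * norm (total - mean) * norm h"
      by (rule norm_B_le)
    also have "\<dots> \<le> bnd * (3 * L) * norm h"
      using norm_base bnd_pos by (intro mult_right_mono mult_left_mono) auto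
    finally have "norm (B (total - mean) h) / (k * L\<^sup>2) \<le> bnd * (3 * L) * norm h / (k * L\<^sup>2)"
      using kL by (simp add: divide_right_mono)
    also have "\<dots> = C1 * norm h / L"
      using L k by (simp add: C1 power2_eq_square)
    finally show ?thesis
      using G(3)[of "B (total - mean) h"] unfolding \<mu>1_def by linarith
  qed
  have "\<exists>b. (\<Sum>i<n. b i) = total + h \<and> area n b = area n a + B total h \<and>
      (\<Sum>i<n. norm (b i))\<^sup>2 \<le> L\<^sup>2 + l h + (8 * bnd * C3 + C2\<^sup>2) * (norm h)\<^sup>2"
    if h: "C3 * norm h \<le> C1 * L" for h
  proof -
    \<comment> \<open>Twice the bound on \<open>\<mu>1 h\<close>, which leaves equal room for the
      quadratic correction. On this ball \<open>C2 * norm h\<close> bounds the perturbing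
      velocities.\<close>
    define r where "r = 2 * C1 * norm h / L"
    define w where "w \<mu> = area n (\<lambda>i. \<tau> i *\<^sub>R vel h \<mu> i)" for \<mu>
    define f where "f \<mu> = G (B (total - mean) h - (1 / 2) *\<^sub>R w \<mu>)" for \<mu>
    have r0: "0 \<le> r"
      using C1pos L by (simp add: r_def)
    have vb: "norm (vel h \<mu> i) \<le> C2 * norm h" if "i < n" "norm \<mu> \<le> r" for i \<mu>
    proof -
      have "norm h + bnd * r * (4 * L) = C2 * norm h"
        using L by (simp add: r_def C2 algebra_simps)
      then show ?thesis
        using norm_vel[OF that, of h] by simp
    qed
    have wb: "norm (w \<mu>) \<le> bnd * (C2 * norm h)\<^sup>2" if "norm \<mu> \<le> r" for \<mu>
    proof -
      have "(\<Sum>i<n. norm (\<tau> i *\<^sub>R vel h \<mu> i)) = (\<Sum>i<n. \<tau> i * norm (vel h \<mu> i))"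
        using \<tau>(1) by simp
      also have "\<dots> \<le> C2 * norm h"
        by (rule mean_le) (rule vb[OF _ that])
      finally have "(\<Sum>i<n. norm (\<tau> i *\<^sub>R vel h \<mu> i))\<^sup>2 \<le> (C2 * norm h)\<^sup>2"
        by (rule power_mono) (auto intro!: sum_nonneg)
      then have "bnd * (\<Sum>i<n. norm (\<tau> i *\<^sub>R vel h \<mu> i))\<^sup>2 \<le> bnd * (C2 * norm h)\<^sup>2"
        using bnd_pos by (intro mult_left_mono) auto
      then show ?thesis
        using norm_area_le[of n "\<lambda>i. \<tau> i *\<^sub>R vel h \<mu> i"] unfolding w_def by linarith
    qed
    \<comment> \<open>\<open>f\<close> depends on \<mu> only through the area term, which is
      quadratic in the velocities; the factor \<open>1 / L\<^sup>2\<close> comes from the inverse of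
      \<open>gram\<close>.\<close>
    have df: "norm (f \<mu> - \<mu>1 h) \<le> C3 * (norm h)\<^sup>2 / L\<^sup>2" if "norm \<mu> \<le> r" for \<mu>
    proof -
      have "f \<mu> - \<mu>1 h = G (- ((1 / 2) *\<^sub>R w \<mu>))"
        unfolding f_def \<mu>1_def linear_diff[OF G(1), symmetric] by simp
      then have "norm (f \<mu> - \<mu>1 h) \<le> (norm (w \<mu>) / 2) / (k * L\<^sup>2)"
        using G(3)[of "- ((1 / 2) *\<^sub>R w \<mu>)"] by simp
      also have "\<dots> \<le> (bnd * (C2 * norm h)\<^sup>2 / 2) / (k * L\<^sup>2)"
        using wb[OF that] kL by (intro divide_right_mono) auto
      also have "\<dots> = C3 * (norm h)\<^sup>2 / L\<^sup>2"
        by (simp add: C3 power_mult_distrib)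
      finally show ?thesis .
    qed
    \<comment> \<open>Here the restriction on \<open>h\<close> enters: the quadratic correction
      stays below the bound for the linear part, so \<open>f\<close> preserves the ball.\<close>
    have small: "C3 * (norm h)\<^sup>2 / L\<^sup>2 \<le> C1 * norm h / L"
    proof -
      have "C3 * (norm h)\<^sup>2 / L\<^sup>2 = (C3 * norm h) * (norm h / L\<^sup>2)"
        by (simp add: power2_eq_square)
      also have "\<dots> \<le> (C1 * L) * (norm h / L\<^sup>2)"
        using h by (intro mult_right_mono) auto
      also have "\<dots> = C1 * norm h / L"
        using L by (simp add: power2_eq_square)
      finally show ?thesis .
    qed
    have fim: "f \<in> cball 0 r \<rightarrow> cball 0 r"
    proof
      fix \<mu> :: "real ^ 'k" assume "\<mu> \<in> cball 0 r"
      then have "norm (f \<mu> - \<mu>1 h) \<le> C1 * norm h / L"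
        using df[of \<mu>] small by simp
      then have "norm (f \<mu>) \<le> C1 * norm h / L + C1 * norm h / L"
        using norm_\<mu>1[of h] norm_triangle_sub[of "f \<mu>" "\<mu>1 h"] by linarith
      then show "f \<mu> \<in> cball 0 r"
        by (simp add: r_def)
    qed
    have cont: "continuous_on (cball 0 r) f"
    proof -
      have "continuous_on (cball 0 r) w"
        unfolding w_def vel_def
        by (intro continuous_on_area continuous_on_scaleR continuous_on_const continuous_on_add
          adj.continuous_on continuous_on_id)
      then have "continuous_on (cball 0 r) (\<lambda>\<mu>. B (total - mean) h - (1 / 2) *\<^sub>R w \<mu>)"
        by (intro continuous_on_diff continuous_on_scaleR continuous_on_const)
      then show ?thesis
        unfolding f_def
        by (rule bounded_linear.continuous_on[OF linear_conv_bounded_linear[THEN iffD1, OF G(1)]])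
    qed
    obtain \<mu> where \<mu>: "\<mu> \<in> cball 0 r" "f \<mu> = \<mu>"
      by (rule brouwer[OF compact_cball convex_cball _ cont fim]) (use r0 in auto)
    have \<mu>r: "norm \<mu> \<le> r"
      using \<mu>(1) by simp
    have "gram \<mu> = gram (f \<mu>)"
      using \<mu>(2) by simp
    then have gram: "gram \<mu> = B (total - mean) h - (1 / 2) *\<^sub>R area n (\<lambda>i. \<tau> i *\<^sub>R vel h \<mu> i)"
      unfolding f_def G(2) w_def .
    define b where "b i = a i + \<tau> i *\<^sub>R vel h \<mu> i" for i
    have "(\<Sum>i<n. b i) = total + h"
      by (simp add: b_def sum.distrib sum_vel total_def)
    moreover have "area n b = area n a + B total h"
      unfolding b_def by (rule area_perturbed[OF gram])
    moreover have "(\<Sum>i<n. norm (b i))\<^sup>2 \<le> L\<^sup>2 + l h + (8 * bnd * C3 + C2\<^sup>2) * (norm h)\<^sup>2"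
    proof -
      \<comment> \<open>Replacing \<mu> by \<open>\<mu>1 h\<close> costs \<open>L\<close> from
        \<open>g\<close>, \<open>4 * L\<close> from \<open>dev\<close> and
        \<open>1 / L\<^sup>2\<close> from the error, so the powers of \<open>L\<close>
        cancel.\<close>
      have "(\<Sum>i<n. \<tau> i * (g i \<bullet> adj (\<mu> - \<mu>1 h) (dev i))) \<le> 4 * bnd * C3 * (norm h)\<^sup>2"
      proof (rule mean_le)
        fix i assume i: "i < n"
        have d: "norm (\<mu> - \<mu>1 h) \<le> C3 * (norm h)\<^sup>2 / L\<^sup>2"
          using df[OF \<mu>r] \<mu>(2) by (simp only:)
        have "norm (adj (\<mu> - \<mu>1 h) (dev i)) \<le> bnd * norm (\<mu> - \<mu>1 h) * norm (dev i)"
          by (rule norm_adj_le)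
        also have "\<dots> \<le> bnd * (C3 * (norm h)\<^sup>2 / L\<^sup>2) * (4 * L)"
          by (rule mult_mono[OF mult_left_mono[OF d] norm_dev[OF i]]) (use bnd_pos C3pos in simp_all)
        finally have "L * norm (adj (\<mu> - \<mu>1 h) (dev i)) \<le> L * (bnd * (C3 * (norm h)\<^sup>2 / L\<^sup>2) * (4 * L))"
          by (rule mult_left_mono) (use L in simp)
        also have "\<dots> = 4 * bnd * (C3 * (norm h)\<^sup>2) * (L\<^sup>2 / L\<^sup>2)"
          by (simp add: power2_eq_square)
        also have "\<dots> = 4 * bnd * C3 * (norm h)\<^sup>2"
          using L by simp
        finally have "L * norm (adj (\<mu> - \<mu>1 h) (dev i)) \<le> 4 * bnd * C3 * (norm h)\<^sup>2" .
        moreover have "g i \<bullet> adj (\<mu> - \<mu>1 h) (dev i) \<le> norm (g i) * norm (adj (\<mu> - \<mu>1 h) (dev i))"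
          by (rule norm_cauchy_schwarz)
        moreover have "norm (g i) * norm (adj (\<mu> - \<mu>1 h) (dev i)) \<le> L * norm (adj (\<mu> - \<mu>1 h) (dev i))"
          using g[OF i] by (intro mult_right_mono) auto
        ultimately show "g i \<bullet> adj (\<mu> - \<mu>1 h) (dev i) \<le> 4 * bnd * C3 * (norm h)\<^sup>2"
          by linarith
      qed
      moreover have "(\<Sum>i<n. \<tau> i * (g i \<bullet> vel h \<mu> i)) =
          (\<Sum>i<n. \<tau> i * (g i \<bullet> vel h (\<mu>1 h) i)) + (\<Sum>i<n. \<tau> i * (g i \<bullet> adj (\<mu> - \<mu>1 h) (dev i)))"
      proof -
        have "vel h \<mu> i = vel h (\<mu>1 h) i + adj (\<mu> - \<mu>1 h) (dev i)" for i
          by (simp add: vel_def adj.diff_left)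
        then show ?thesis
          by (simp add: inner_add_right distrib_left sum.distrib)
      qed
      ultimately have "2 * (\<Sum>i<n. \<tau> i * (g i \<bullet> vel h \<mu> i)) \<le> l h + 8 * bnd * C3 * (norm h)\<^sup>2"
        unfolding l_def by linarith
      moreover have "(\<Sum>i<n. norm (b i))\<^sup>2 \<le> L\<^sup>2 + 2 * (\<Sum>i<n. \<tau> i * (g i \<bullet> vel h \<mu> i)) + (C2 * norm h)\<^sup>2"
        unfolding b_def by (rule energy_perturbed) (rule vb[OF _ \<mu>r])
      ultimately show ?thesis
        by (simp add: power_mult_distrib distrib_right)
    qed
    ultimately show ?thesis
      by (intro exI[of _ b] conjI)
  qed
  then show ?thesis
    using odd by (intro exI[of _ l] conjI allI impI)
qed

end

subsection \<open>Horizontal semiconcavity\<close>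

context ideal_group
begin

lemma hdist_sq_semiconcave:
  "\<exists>C\<ge>0. \<forall>p h. (hdist B (gmul B p (h, 0)))\<^sup>2 + (hdist B (gmul B p (- h, 0)))\<^sup>2 - 2 * (hdist B p)\<^sup>2
    \<le> C * (norm h)\<^sup>2"
proof -
  obtain C0 where C0: "0 < C0" "\<And>p. hdist B p \<le> C0 * (norm (fst p) + sqrt (norm (snd p)))"
    using ball_box by blast
  obtain c where c: "0 < c" "\<And>\<mu> x. c * norm \<mu> * norm x \<le> norm (adj \<mu> x)"
    using norm_adj_ge by blast
  define E where "E = 8 * C0\<^sup>2 * (1 + 2 * bnd) + 1"
  define F where "F = 8 * C0\<^sup>2 * bnd"
  define S where "S = 2 * (16 * E\<^sup>2 + F)"
  \<comment> \<open>\<open>c\<close> is the lower bound of \<open>adj\<close> and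
    \<open>L / S\<close> that of the mean deviation; coercivity concerns their squares.\<close>
  define k where "k = (c / S)\<^sup>2"
  define C1 where "C1 = 3 * bnd / k"
  define C2 where "C2 = 1 + 8 * bnd * C1"
  define C3 where "C3 = bnd * C2\<^sup>2 / (2 * k)"
  \<comment> \<open>The perturbation argument needs \<open>R * norm h \<le> L\<close>; this ratio
    separates it from the case of the triangle inequality.\<close>
  define R where "R = C3 / C1"
  define Q where "Q = 8 * bnd * C3 + C2\<^sup>2"
  have E: "1 \<le> E"
    using bnd_pos by (simp add: E_def)
  have F: "0 \<le> F"
    using bnd_pos by (simp add: F_def)
  have "0 < 16 * E\<^sup>2"
    using E by simp
  then have S: "0 < S"
    using F by (simp add: S_def add_pos_nonneg)
  have k: "0 < k"
    using c(1) S by (simp add: k_def)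
  have C1: "0 < C1"
    using bnd_pos k by (simp add: C1_def)
  have C3: "0 \<le> C3"
    using bnd_pos k by (simp add: C3_def)
  have R: "0 \<le> R"
    using C1 C3 by (simp add: R_def)
  have Q: "0 \<le> Q"
    using bnd_pos C3 by (simp add: Q_def)
  have far: "(hdist B (gmul B p (h, 0)))\<^sup>2 + (hdist B (gmul B p (- h, 0)))\<^sup>2 - 2 * (hdist B p)\<^sup>2
      \<le> 2 * Q * (norm h)\<^sup>2 + e" if h: "R * norm h < hdist B p" and "0 < e" for p h e
  proof -
    let ?D = "hdist B p"
    have D: "0 < ?D"
      using h mult_nonneg_nonneg[OF R norm_ge_zero[of h]] by linarith
    \<comment> \<open>The first bound gives the factor 2 required by \<open>spread\<close>; the
      second keeps the loss \<open>2 * (L\<^sup>2 - ?D\<^sup>2)\<close> at most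
      \<open>e\<close>.\<close>
    define \<rho> where "\<rho> = min (2 * ?D) (sqrt (?D\<^sup>2 + e / 2))"
    have "sqrt (?D\<^sup>2) < sqrt (?D\<^sup>2 + e / 2)"
      using \<open>0 < e\<close> by (intro real_sqrt_less_mono) simp
    then have "?D < \<rho>"
      using D by (simp add: \<rho>_def)
    then obtain xs where xs: "hprod B xs = p" "hlen xs < \<rho>"
      using hdist_approx by blast
    obtain N where N: "inverse (real (Suc N)) < 1 / (8 * E)"
      using reals_Archimedean[of "1 / (8 * E)"] E by auto
    obtain ys where ys: "hprod B ys = hprod B xs" "hlen ys = hlen xs"
      "\<And>y. y \<in> set ys \<Longrightarrow> norm y \<le> hlen xs / real (Suc N)"
      by (rule refine_list[of "Suc N" xs]) auto
    define L where "L = hlen xs"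
    have DL: "?D \<le> L"
      unfolding L_def by (rule hdist_le[OF xs(1)])
    have L: "0 < L"
      using D DL by linarith
    have L2: "L \<le> 2 * ?D" "L\<^sup>2 \<le> ?D\<^sup>2 + e / 2"
    proof -
      show "L \<le> 2 * ?D"
        using xs(2) unfolding L_def \<rho>_def by linarith
      have "L \<le> sqrt (?D\<^sup>2 + e / 2)"
        using xs(2) unfolding L_def \<rho>_def by linarith
      then have "L\<^sup>2 \<le> (sqrt (?D\<^sup>2 + e / 2))\<^sup>2"
        using L by (intro power_mono) auto
      also have "\<dots> = ?D\<^sup>2 + e / 2"
        by (rule real_sqrt_pow2) (use \<open>0 < e\<close> in simp)
      finally show "L\<^sup>2 \<le> ?D\<^sup>2 + e / 2" .
    qed
    define n where "n = length ys"
    \<comment> \<open>Reparametrisation with time proportional to length and speed \<open>L\<close>;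
      \<open>sgn 0 = 0\<close> covers vanishing steps.\<close>
    define \<tau> where "\<tau> i = norm (ys ! i) / L" for i
    define g where "g i = L *\<^sub>R sgn (ys ! i)" for i
    have a: "\<tau> i *\<^sub>R g i = ys ! i" for i
      using L by (cases "ys ! i = 0") (simp_all add: \<tau>_def g_def sgn_div_norm)
    have map_ys: "map ((!) ys) [0..<n] = ys"
      unfolding n_def by (rule map_nth)
    have sum_\<tau>: "(\<Sum>i<n. \<tau> i) = 1"
      using hlen_upt[of "(!) ys" n] L ys(2) unfolding map_ys \<tau>_def L_def
      by (simp add: sum_divide_distrib[symmetric])
    let ?a = "\<lambda>i. \<tau> i *\<^sub>R g i" and ?tot = "\<Sum>i<n. \<tau> i *\<^sub>R g i"
    let ?mid = "\<lambda>i. (\<Sum>j<i. \<tau> j *\<^sub>R g j) + (1 / 2) *\<^sub>R (\<tau> i *\<^sub>R g i)"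
    let ?mean = "\<Sum>i<n. \<tau> i *\<^sub>R ?mid i"
    let ?dev = "\<lambda>i. ?mid i - ?mean"
    have \<tau>0: "0 \<le> \<tau> i" for i
      using L by (simp add: \<tau>_def)
    interpret T: timed_path B n \<tau> g L ?a ?mid ?dev ?tot ?mean
    proof unfold_locales
      show "norm (g i) \<le> L" for i
        using L by (simp add: g_def norm_sgn)
    qed (use sum_\<tau> L \<tau>0 in auto)
    have p: "p = (?tot, area n ?a)"
      using hprod_upt[of ?a n] xs(1) ys(1) map_ys unfolding a area_def by simp
    have fine: "\<tau> i \<le> 1 / (8 * E)" if "i < n" for i
    proof -
      have "norm (ys ! i) \<le> L / real (Suc N)"
        unfolding L_def by (rule ys(3)) (use that in \<open>simp add: n_def\<close>)
      then have "\<tau> i \<le> (L / real (Suc N)) / L"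
        unfolding \<tau>_def using L by (intro divide_right_mono) auto
      also have "\<dots> = inverse (real (Suc N))"
        using L by (simp add: inverse_eq_divide)
      finally show ?thesis
        using N by linarith
    qed
    have short: "L \<le> 2 * hdist B (?tot, area n ?a)"
      using L2(1) unfolding p[symmetric] .
    have "L \<le> S * (\<Sum>i<n. \<tau> i * norm (?dev i))"
      unfolding S_def by (rule T.spread[OF C0 E_def F_def fine short])
    then have "L / S \<le> (\<Sum>i<n. \<tau> i * norm (?dev i))"
      using S by (simp only: pos_divide_le_eq mult.commute)
    then have "(L / S)\<^sup>2 \<le> (\<Sum>i<n. \<tau> i * norm (?dev i))\<^sup>2"
      by (rule power_mono) (use L S in simp)
    also have "\<dots> \<le> (\<Sum>i<n. \<tau> i * (norm (?dev i))\<^sup>2)"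
      by (rule square_weighted_sum_le) (use \<tau>0 sum_\<tau> in auto)
    finally have spread: "(L / S)\<^sup>2 \<le> (\<Sum>i<n. \<tau> i * (norm (?dev i))\<^sup>2)" .
    \<comment> \<open>Fatness bounds each \<open>adj \<mu> (?dev i)\<close> from below, and the
      spread bounds the deviations in mean square.\<close>
    have coercive: "k * L\<^sup>2 * (norm \<mu>)\<^sup>2 \<le> (\<Sum>i<n. \<tau> i * (norm (adj \<mu> (?dev i)))\<^sup>2)" for \<mu>
    proof -
      have "k * L\<^sup>2 * (norm \<mu>)\<^sup>2 = (c * norm \<mu>)\<^sup>2 * (L / S)\<^sup>2"
        by (simp add: k_def power_mult_distrib power_divide)
      also have "\<dots> \<le> (c * norm \<mu>)\<^sup>2 * (\<Sum>i<n. \<tau> i * (norm (?dev i))\<^sup>2)"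
        using spread by (rule mult_left_mono) simp
      also have "\<dots> = (\<Sum>i<n. \<tau> i * (c * norm \<mu> * norm (?dev i))\<^sup>2)"
        unfolding sum_distrib_left by (simp only: power_mult_distrib mult_ac)
      also have "\<dots> \<le> (\<Sum>i<n. \<tau> i * (norm (adj \<mu> (?dev i)))\<^sup>2)"
      proof (rule sum_mono)
        fix i
        have "(c * norm \<mu> * norm (?dev i))\<^sup>2 \<le> (norm (adj \<mu> (?dev i)))\<^sup>2"
          using c(2) by (rule power_mono) (use c(1) in simp)
        then show "\<tau> i * (c * norm \<mu> * norm (?dev i))\<^sup>2 \<le> \<tau> i * (norm (adj \<mu> (?dev i)))\<^sup>2"
          using \<tau>0 by (rule mult_left_mono)
      qed
      finally show ?thesis .
    qed
    interpret P: coercive_path where B = B and n = n and \<tau> = \<tau> and g = g and L = L and k = k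
      and a = ?a and mid = ?mid and dev = ?dev and total = ?tot and mean = ?mean
      by unfold_locales (rule k, rule coercive)
    obtain l where l': "(\<forall>h. l (- h) = - l h) \<and> (\<forall>h. C3 * norm h \<le> C1 * L \<longrightarrow>
        (\<exists>b. (\<Sum>i<n. b i) = ?tot + h \<and> area n b = area n ?a + B ?tot h \<and>
          (\<Sum>i<n. norm (b i))\<^sup>2 \<le> L\<^sup>2 + l h + Q * (norm h)\<^sup>2))"
      using P.ex_perturbation[OF C1_def C2_def C3_def] unfolding Q_def by (elim exE)
    note l = conjunct1[OF l', rule_format] conjunct2[OF l', rule_format]
    have "R * norm h \<le> L"
      using h DL by linarith
    then have hL: "C3 * norm h \<le> C1 * L"
      using C1 by (simp add: R_def field_simps)
    have step: "(hdist B (gmul B p (v, 0)))\<^sup>2 \<le> L\<^sup>2 + l v + Q * (norm v)\<^sup>2" if v: "C3 * norm v \<le> C1 * L" for v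
    proof -
      obtain b where b: "(\<Sum>i<n. b i) = ?tot + v" "area n b = area n ?a + B ?tot v"
        "(\<Sum>i<n. norm (b i))\<^sup>2 \<le> L\<^sup>2 + l v + Q * (norm v)\<^sup>2"
        using l(2)[OF v] by blast
      have "hprod B (map b [0..<n]) = (?tot + v, area n ?a + B ?tot v)"
        unfolding hprod_upt area_def[symmetric] b(1,2) ..
      also have "\<dots> = gmul B p (v, 0)"
        by (subst p) (simp add: gmul_def)
      finally have "hdist B (gmul B p (v, 0)) \<le> (\<Sum>i<n. norm (b i))"
        unfolding hlen_upt[symmetric] by (rule hdist_le)
      then have "(hdist B (gmul B p (v, 0)))\<^sup>2 \<le> (\<Sum>i<n. norm (b i))\<^sup>2"
        by (rule power_mono) (rule hdist_nonneg)
      then show ?thesis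
        using b(3) by linarith
    qed
    have "(hdist B (gmul B p (h, 0)))\<^sup>2 \<le> L\<^sup>2 + l h + Q * (norm h)\<^sup>2"
      by (rule step) (rule hL)
    \<comment> \<open>Oddness of \<open>l\<close> cancels the first-order terms. The resulting bound
      no longer sees the chosen polygon, so \<open>e\<close> can later tend to 0.\<close>
    moreover have "(hdist B (gmul B p (- h, 0)))\<^sup>2 \<le> L\<^sup>2 - l h + Q * (norm h)\<^sup>2"
      using step[of "- h"] hL l(1)[of h] by simp
    ultimately show ?thesis
      using L2(2) unfolding mult.assoc by linarith
  qed
  have near: "(hdist B (gmul B p (h, 0)))\<^sup>2 + (hdist B (gmul B p (- h, 0)))\<^sup>2 - 2 * (hdist B p)\<^sup>2
      \<le> 2 * (R + 1)\<^sup>2 * (norm h)\<^sup>2" if h: "hdist B p \<le> R * norm h" for p h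
  proof -
    have "(hdist B (gmul B p (v, 0)))\<^sup>2 \<le> ((R + 1) * norm v)\<^sup>2" if "norm v = norm h" for v
    proof (rule power_mono[OF _ hdist_nonneg])
      show "hdist B (gmul B p (v, 0)) \<le> (R + 1) * norm v"
        using hdist_gmul_le[of p "(v, 0)"] hdist_horizontal[of v] h that by (simp add: distrib_right)
    qed
    from this[of h] this[of "- h"] have "(hdist B (gmul B p (h, 0)))\<^sup>2 \<le> (R + 1)\<^sup>2 * (norm h)\<^sup>2"
        "(hdist B (gmul B p (- h, 0)))\<^sup>2 \<le> (R + 1)\<^sup>2 * (norm h)\<^sup>2"
      by (simp_all add: power_mult_distrib)
    then show ?thesis
      using zero_le_power2[of "hdist B p"] unfolding mult.assoc by linarith
  qed
  show ?thesis
  proof (intro exI conjI allI)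
    show "0 \<le> 2 * (R + 1)\<^sup>2 + 2 * Q"
      using Q by simp
    fix p h
    let ?x = "(hdist B (gmul B p (h, 0)))\<^sup>2 + (hdist B (gmul B p (- h, 0)))\<^sup>2 - 2 * (hdist B p)\<^sup>2"
    have nn: "0 \<le> 2 * (R + 1)\<^sup>2 * (norm h)\<^sup>2" "0 \<le> 2 * Q * (norm h)\<^sup>2"
      using Q by simp_all
    show "?x \<le> (2 * (R + 1)\<^sup>2 + 2 * Q) * (norm h)\<^sup>2"
    proof (cases "hdist B p \<le> R * norm h")
      case True
      then show ?thesis
        using near[OF True] nn unfolding distrib_right by linarith
    next
      case False
      then have "?x \<le> 2 * Q * (norm h)\<^sup>2"
        by (intro field_le_epsilon[OF far]) auto
      then show ?thesis
        using nn unfolding distrib_right by linarith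
    qed
  qed
qed

end

theorem theorem3p1:
  fixes B :: "real ^ 'm \<Rightarrow> real ^ 'm \<Rightarrow> real ^ 'k"
  assumes "ideal_carnot B"
  shows "h_semiconcave B UNIV (\<lambda>p. (cc_dist B p 0)\<^sup>2)"
proof -
  interpret ideal_group B
    by unfold_locales (rule assms)
  have "isCont (\<lambda>p. (hdist B p)\<^sup>2) p" for p
    by (intro isCont_power continuous_hdist)
  then have "lsc_on UNIV (\<lambda>p. (hdist B p)\<^sup>2)"
    unfolding lsc_on_def isCont_def using order_tendstoD(1) by fast
  moreover obtain C where C: "0 \<le> C"
    "\<And>p h. (hdist B (gmul B p (h, 0)))\<^sup>2 + (hdist B (gmul B p (- h, 0)))\<^sup>2 - 2 * (hdist B p)\<^sup>2 \<le> C * (norm h)\<^sup>2"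
    using hdist_sq_semiconcave by blast
  have "(hdist B (gmul B p h))\<^sup>2 + (hdist B (gmul B p (ginv h)))\<^sup>2 - 2 * (hdist B p)\<^sup>2 \<le> C * (norm h)\<^sup>2"
    if h: "snd h = 0" for p h
  proof -
    obtain v where "h = (v, 0)"
      using h by (metis prod.collapse)
    then show ?thesis
      using C(2)[of p v] by (simp add: ginv_def norm_Pair)
  qed
  ultimately show ?thesis
    unfolding h_semiconcave_def cc_dist_origin using C(1) by blast
qed

end
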